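(* Each $\xi\in\mathfrak{S}$ admits a unique decomposition $\xi=\xi^{uc}+\xi^{up}$ with $\xi^{uc}\in\mathfrak{S}^{uc}$ and $\xi^{up}\in\mathfrak{S}^{up}$.
   Context: $\Omega$ is a set, $(\mathcal{A}_t)_{t\in\mathbb{R}_+}$ an increasing family of algebras of subsets of $\Omega$, $\mathcal{A}=\bigcup_{t}\mathcal{A}_t$, and $\mathcal{F}$ the $\sigma$-algebra generated by $\mathcal{A}$. For an algebra $\mathcal{G}$, $ba(\mathcal{G})$ is the Banach lattice of bounded finitely additive real set functions on $\mathcal{G}$ (total variation norm), $ca(\mathcal{G})$ the subspace of countably additive ones, $pfa(\mathcal{G})$ the subspace of purely finitely additive ones (the orthogonal complement of $ca(\mathcal{G})$), and a subscript $+$ denotes positive elements. A finitely additive supermartingale is a family $\xi=(\xi_t)_{t\in\mathbb{R}_+}$ with $\xi_t\in ba(\mathcal{A}_t)$ and $\xi_t(F)\ge\xi_u(F)$ for $t\le u$, $F\in\mathcal{A}_t$; $\mathfrak{S}$ is the set of those with $\sup_t\|\xi_t\|<\infty$. For $\xi\in\mathfrak{S}$ and $F\in\mathcal{A}$, $\xi_\infty(F)=\inf_{\{t:F\in\mathcal{A}_t\}}\xi_t(F)$. Let $\bar\Omega=\Omega\times\mathbb{R}_+$, $\bar{\mathcal{F}}=\{F\times\mathbb{R}_+:F\in\mathcal{F}\}$ and $\mathfrak{M}=\{\bar x\in ba(2^{\bar\Omega})_+:\lim_{t\to\infty}\bar x(\Omega\times]t,\infty[)=0\}$. For $\xi\in\mathfrak{S}$,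 $\mathfrak{M}(\xi)$ is the set of $\bar x\in\mathfrak{M}$ with $\xi_t(F)=\xi_\infty(F)+\bar x(F\times]t,\infty[)$ for all $t\in\mathbb{R}_+$, $F\in\mathcal{A}_t$. $\mathfrak{M}^{uc}$ (resp. $\mathfrak{M}^{up}$) is the set of $\bar x\in\mathfrak{M}$ with $\bar x|_{\bar{\mathcal{F}}}\in ca(\bar{\mathcal{F}})$ (resp. $\bar x|_{\bar{\mathcal{F}}}\in pfa(\bar{\mathcal{F}})$). Finally $$\mathfrak{S}^{uc}=\{\xi\in\mathfrak{S}:\xi_\infty\in ca(\mathcal{A}),\ \mathfrak{M}(\xi)\cap\mathfrak{M}^{uc}\neq\varnothing\},\qquad \mathfrak{S}^{up}=\{\xi\in\mathfrak{S}:\xi_\infty\in pfa(\mathcal{A}),\ \mathfrak{M}(\xi)\subset\mathfrak{M}^{up}\}.$$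
   Formalization: The claim fails as stated because the equations defining M(ξ) leave the mass on Ω×{0} free, making S^up empty for nonempty Ω; here, in the definition of S^up, the inclusion M(ξ) ⊂ M^up is required only of those x̄ in M(ξ) with x̄(Ω×{0}) = 0. *)

theory Defs
  imports "HOL-Analysis.Analysis"
begin

section \<open>Bounded finitely additive set functions\<close>

text \<open>
  A real set function on a family \<open>G\<close> of sets is represented by a total function that is \<open>0\<close>
  off \<open>G\<close>. The representative is thereby unique, so equality of set functions is HOL equality,
  and sums and negatives are the pointwise ones. Likewise, a family indexed by
  \<open>t \<ge> 0\<close> is a function on all reals whose members with negative index are \<open>0\<close>.
\<close>

definition ba :: "'a set set \<Rightarrow> ('a set \<Rightarrow> real) set" where
  "ba G = {m. additive G m \<and> (\<exists>c. \<forall>F\<in>G. \<bar>m F\<bar> \<le> c) \<and> (\<forall>F. F \<notin> G \<longrightarrow> m F = 0)}"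

definition ba_pos :: "'a set set \<Rightarrow> ('a set \<Rightarrow> real) set" where
  "ba_pos G = {m \<in> ba G. \<forall>F\<in>G. 0 \<le> m F}"

definition ba_norm :: "'a set set \<Rightarrow> ('a set \<Rightarrow> real) \<Rightarrow> ereal" where
  "ba_norm G m =
    (SUP P \<in> {P. finite P \<and> P \<subseteq> G \<and> disjoint P}. ereal (\<Sum>F\<in>P. \<bar>m F\<bar>))"

definition ca :: "'a set set \<Rightarrow> ('a set \<Rightarrow> real) set" where
  "ca G = {m \<in> ba G. \<forall>f :: nat \<Rightarrow> 'a set.
     range f \<subseteq> G \<longrightarrow> disjoint_family f \<longrightarrow> (\<Union>i. f i) \<in> G \<longrightarrow> (\<lambda>i. m (f i)) sums m (\<Union>i. f i)}"

definition ba_le :: "'a set set \<Rightarrow> ('a set \<Rightarrow> real) \<Rightarrow> ('a set \<Rightarrow> real) \<Rightarrow> bool" where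
  "ba_le G m l \<longleftrightarrow> (\<forall>F\<in>G. m F \<le> l F)"

definition is_ba_sup ::
  "'a set set \<Rightarrow> ('a set \<Rightarrow> real) \<Rightarrow> ('a set \<Rightarrow> real) \<Rightarrow> ('a set \<Rightarrow> real) \<Rightarrow> bool" where
  "is_ba_sup G m l s \<longleftrightarrow> s \<in> ba G \<and> ba_le G m s \<and> ba_le G l s \<and>
     (\<forall>u\<in>ba G. ba_le G m u \<longrightarrow> ba_le G l u \<longrightarrow> ba_le G s u)"

definition ba_sup ::
  "'a set set \<Rightarrow> ('a set \<Rightarrow> real) \<Rightarrow> ('a set \<Rightarrow> real) \<Rightarrow> ('a set \<Rightarrow> real)" where
  "ba_sup G m l = (THE s. is_ba_sup G m l s)"

definition ba_inf ::
  "'a set set \<Rightarrow> ('a set \<Rightarrow> real) \<Rightarrow> ('a set \<Rightarrow> real) \<Rightarrow> ('a set \<Rightarrow> real)" where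
  "ba_inf G m l = (\<lambda>F. - ba_sup G (\<lambda>E. - m E) (\<lambda>E. - l E) F)"

definition ba_abs :: "'a set set \<Rightarrow> ('a set \<Rightarrow> real) \<Rightarrow> ('a set \<Rightarrow> real)" where
  "ba_abs G m = ba_sup G m (\<lambda>E. - m E)"

definition pfa :: "'a set set \<Rightarrow> ('a set \<Rightarrow> real) set" where
  "pfa G = {m \<in> ba G. \<forall>l\<in>ca G. ba_inf G (ba_abs G m) (ba_abs G l) = (\<lambda>_. 0)}"

definition restr :: "'a set set \<Rightarrow> ('a set \<Rightarrow> real) \<Rightarrow> ('a set \<Rightarrow> real)" where
  "restr G m = (\<lambda>F. if F \<in> G then m F else 0)"

text \<open>
  On an algebra the description in \<^const>\<open>ba_sup\<close> denotes, and it is given by the usual formula.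
\<close>

lemma is_ba_sup_unique:
  assumes "is_ba_sup G m l s" "is_ba_sup G m l s'"
  shows "s = s'"
proof
  fix F
  have "ba_le G s s'" "ba_le G s' s" "s \<in> ba G" "s' \<in> ba G"
    using assms by (auto simp: is_ba_sup_def)
  then show "s F = s' F"
    by (cases "F \<in> G") (auto simp: ba_le_def ba_def intro: antisym)
qed

lemma is_ba_sup_formula:
  assumes alg: "algebra \<Omega> G" and m: "m \<in> ba G" and l: "l \<in> ba G"
  shows "is_ba_sup G m l
    (\<lambda>F. if F \<in> G then (SUP E \<in> {E\<in>G. E \<subseteq> F}. m E + l (F - E)) else 0)"
proof -
  interpret algebra \<Omega> G by (fact alg)
  define T where "T F = (\<lambda>E. m E + l (F - E)) ` {E\<in>G. E \<subseteq> F}" for F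
  define s where "s = (\<lambda>F. if F \<in> G then Sup (T F) else 0)"
  have add: "m (E \<union> F) = m E + m F" "l (E \<union> F) = l E + l F"
    if "E \<in> G" "F \<in> G" "E \<inter> F = {}" for E F
    using m l that by (auto simp: ba_def additive_def)
  have z: "m {} = 0" "l {} = 0"
    using add[of "{}" "{}"] by auto
  obtain c where c: "\<And>F. F \<in> G \<Longrightarrow> \<bar>m F\<bar> \<le> c"
    using m by (auto simp: ba_def)
  obtain d where d: "\<And>F. F \<in> G \<Longrightarrow> \<bar>l F\<bar> \<le> d"
    using l by (auto simp: ba_def)
  have bd: "\<bar>x\<bar> \<le> c + d" if "F \<in> G" "x \<in> T F" for F x
  proof -
    from that obtain E where E: "E \<in> G" "x = m E + l (F - E)" by (auto simp: T_def)
    have "F - E \<in> G" using E(1) that(1) by blast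
    then show ?thesis using c[OF E(1)] d[of "F - E"] E(2) by linarith
  qed
  have ba: "bdd_above (T F)" if "F \<in> G" for F
    using bd[OF that] by (intro bdd_aboveI[of _ "c + d"]) (auto simp: abs_le_iff)
  have inT: "m E + l (F - E) \<in> T F" if "E \<in> G" "E \<subseteq> F" for E F
    using that by (auto simp: T_def)
  have up: "m E + l (F - E) \<le> s F" if "F \<in> G" "E \<in> G" "E \<subseteq> F" for E F
    using cSup_upper[OF inT ba] that by (auto simp: s_def)
  have ne: "T F \<noteq> {}" for F
    using inT[of "{}" F] by auto
  have least: "s F \<le> b" if "F \<in> G" "\<And>E. E \<in> G \<Longrightarrow> E \<subseteq> F \<Longrightarrow> m E + l (F - E) \<le> b" for F b
    using that cSup_least[OF ne, of F b] by (auto simp: s_def T_def)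
  have sba: "s \<in> ba G"
  proof -
    have "s (A \<union> B) = s A + s B" if AB: "A \<in> G" "B \<in> G" "A \<inter> B = {}" for A B
    proof (rule antisym)
      have U: "A \<union> B \<in> G" using AB by auto
      show "s (A \<union> B) \<le> s A + s B"
      proof (rule least[OF U])
        fix E assume E: "E \<in> G" "E \<subseteq> A \<union> B"
        have "m E = m (E \<inter> A) + m (E \<inter> B)"
          using add(1)[of "E \<inter> A" "E \<inter> B"] E AB
          by (metis Int Int_Un_distrib Int_absorb2 Int_assoc Int_commute Int_empty_right)
        moreover have "l (A \<union> B - E) = l (A - E \<inter> A) + l (B - E \<inter> B)"
        proof -
          have "A \<union> B - E = (A - E \<inter> A) \<union> (B - E \<inter> B)" by auto
          then show ?thesis using add(2)[of "A - E \<inter> A" "B - E \<inter> B"] E AB by auto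
        qed
        moreover have "E \<inter> A \<in> G" "E \<inter> B \<in> G" using E AB by blast+
        ultimately show "m E + l (A \<union> B - E) \<le> s A + s B"
          using up[of A "E \<inter> A"] up[of B "E \<inter> B"] AB by simp
      qed
      have step: "m C + l (A - C) + (m D + l (B - D)) \<le> s (A \<union> B)"
        if CD: "C \<in> G" "C \<subseteq> A" "D \<in> G" "D \<subseteq> B" for C D
      proof -
        have "m (C \<union> D) = m C + m D" using add(1)[of C D] CD AB by auto
        moreover have "l (A \<union> B - (C \<union> D)) = l (A - C) + l (B - D)"
        proof -
          have "A \<union> B - (C \<union> D) = (A - C) \<union> (B - D)" using CD AB by auto
          then show ?thesis using add(2)[of "A - C" "B - D"] CD AB by auto
        qed
        moreover have "C \<union> D \<in> G" "C \<union> D \<subseteq> A \<union> B" using CD by auto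
        ultimately show ?thesis using up[of "A \<union> B" "C \<union> D"] U by simp
      qed
      have "s A \<le> s (A \<union> B) - s B"
      proof (rule least[OF AB(1)])
        fix C assume C: "C \<in> G" "C \<subseteq> A"
        have "s B \<le> s (A \<union> B) - (m C + l (A - C))"
          by (rule least[OF AB(2)]) (use step[OF C] in \<open>auto simp: algebra_simps\<close>)
        then show "m C + l (A - C) \<le> s (A \<union> B) - s B" by simp
      qed
      then show "s A + s B \<le> s (A \<union> B)" by simp
    qed
    moreover have "\<bar>s F\<bar> \<le> c + d" if F: "F \<in> G" for F
    proof -
      have "s F \<le> c + d"
        by (rule least[OF F]) (use bd[OF F inT] in \<open>auto simp: abs_le_iff\<close>)
      moreover have "- (c + d) \<le> s F"
        using up[OF F, of "{}"] bd[OF F inT[of "{}"]] by (auto simp: abs_le_iff)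
      ultimately show ?thesis by (simp add: abs_le_iff)
    qed
    ultimately show ?thesis
      unfolding ba_def additive_def by (auto simp: s_def)
  qed
  have "is_ba_sup G m l s"
    unfolding is_ba_sup_def
  proof (intro conjI ballI impI sba)
    show "ba_le G m s" using up[of F F for F] z by (auto simp: ba_le_def)
    show "ba_le G l s" using up[of F "{}" for F] z by (auto simp: ba_le_def)
    fix u assume u: "u \<in> ba G" "ba_le G m u" "ba_le G l u"
    show "ba_le G s u"
      unfolding ba_le_def
    proof
      fix F assume F: "F \<in> G"
      show "s F \<le> u F"
      proof (rule least[OF F])
        fix E assume E: "E \<in> G" "E \<subseteq> F"
        have FE: "F - E \<in> G" using E F by blast
        have "u (E \<union> (F - E)) = u E + u (F - E)"
          using additiveD[of G u E "F - E"] u(1) E(1) FE by (auto simp: ba_def)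
        moreover have "E \<union> (F - E) = F" using E by auto
        moreover have "m E \<le> u E" "l (F - E) \<le> u (F - E)"
          using u E FE by (auto simp: ba_le_def)
        ultimately show "m E + l (F - E) \<le> u F" by simp
      qed
    qed
  qed
  then show ?thesis unfolding s_def T_def .
qed

lemma is_ba_sup_ba_sup:
  assumes "algebra \<Omega> G" "m \<in> ba G" "l \<in> ba G"
  shows "is_ba_sup G m l (ba_sup G m l)"
proof -
  note f = is_ba_sup_formula[OF assms]
  have "\<exists>!s. is_ba_sup G m l s"
    using f is_ba_sup_unique by blast
  then show ?thesis
    unfolding ba_sup_def by (rule theI')
qed


section \<open>Finitely additive supermartingales\<close>

definition union_alg :: "(real \<Rightarrow> 'a set set) \<Rightarrow> 'a set set" where
  "union_alg A = (\<Union>t\<in>{0..}. A t)"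

definition fa_supermartingale :: "(real \<Rightarrow> 'a set set) \<Rightarrow> (real \<Rightarrow> 'a set \<Rightarrow> real) \<Rightarrow> bool" where
  "fa_supermartingale A \<xi> \<longleftrightarrow>
     (\<forall>t\<ge>0. \<xi> t \<in> ba (A t)) \<and> (\<forall>t<0. \<xi> t = (\<lambda>_. 0)) \<and>
     (\<forall>t\<ge>0. \<forall>u\<ge>t. \<forall>F\<in>A t. \<xi> u F \<le> \<xi> t F)"

definition frakS :: "(real \<Rightarrow> 'a set set) \<Rightarrow> (real \<Rightarrow> 'a set \<Rightarrow> real) set" where
  "frakS A = {\<xi>. fa_supermartingale A \<xi> \<and> (SUP t\<in>{0..}. ba_norm (A t) (\<xi> t)) < \<infinity>}"

definition xi_inf :: "(real \<Rightarrow> 'a set set) \<Rightarrow> (real \<Rightarrow> 'a set \<Rightarrow> real) \<Rightarrow> ('a set \<Rightarrow> real)" where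
  "xi_inf A \<xi> = restr (union_alg A) (\<lambda>F. INF t\<in>{t. 0 \<le> t \<and> F \<in> A t}. \<xi> t F)"


section \<open>Representing set functions on the product with the half line\<close>

definition Omega_bar :: "'a set \<Rightarrow> ('a \<times> real) set" where
  "Omega_bar \<Omega> = \<Omega> \<times> {0..}"

definition F_bar :: "'a set \<Rightarrow> (real \<Rightarrow> 'a set set) \<Rightarrow> ('a \<times> real) set set" where
  "F_bar \<Omega> A = {F \<times> {0..} | F. F \<in> sigma_sets \<Omega> (union_alg A)}"

definition frakM :: "'a set \<Rightarrow> (('a \<times> real) set \<Rightarrow> real) set" where
  "frakM \<Omega> = {x \<in> ba_pos (Pow (Omega_bar \<Omega>)). ((\<lambda>t. x (\<Omega> \<times> {t<..})) \<longlongrightarrow> 0) at_top}"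

definition frakM_of ::
  "'a set \<Rightarrow> (real \<Rightarrow> 'a set set) \<Rightarrow> (real \<Rightarrow> 'a set \<Rightarrow> real) \<Rightarrow> (('a \<times> real) set \<Rightarrow> real) set" where
  "frakM_of \<Omega> A \<xi> = {x \<in> frakM \<Omega>. \<forall>t\<ge>0. \<forall>F\<in>A t. \<xi> t F = xi_inf A \<xi> F + x (F \<times> {t<..})}"

definition frakM_uc :: "'a set \<Rightarrow> (real \<Rightarrow> 'a set set) \<Rightarrow> (('a \<times> real) set \<Rightarrow> real) set" where
  "frakM_uc \<Omega> A = {x \<in> frakM \<Omega>. restr (F_bar \<Omega> A) x \<in> ca (F_bar \<Omega> A)}"

definition frakM_up :: "'a set \<Rightarrow> (real \<Rightarrow> 'a set set) \<Rightarrow> (('a \<times> real) set \<Rightarrow> real) set" where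
  "frakM_up \<Omega> A = {x \<in> frakM \<Omega>. restr (F_bar \<Omega> A) x \<in> pfa (F_bar \<Omega> A)}"

definition frakS_uc :: "'a set \<Rightarrow> (real \<Rightarrow> 'a set set) \<Rightarrow> (real \<Rightarrow> 'a set \<Rightarrow> real) set" where
  "frakS_uc \<Omega> A =
     {\<xi> \<in> frakS A. xi_inf A \<xi> \<in> ca (union_alg A) \<and> frakM_of \<Omega> A \<xi> \<inter> frakM_uc \<Omega> A \<noteq> {}}"

text \<open>
  The equations defining \<^const>\<open>frakM_of\<close> involve only the sets \<open>F \<times> {t<..}\<close> with \<open>t \<ge> 0\<close>,
  hence say nothing about the mass on \<open>\<Omega> \<times> {0}\<close>: adding to an element
  the point mass at some \<open>(\<omega>, 0)\<close>, whose restriction to \<^const>\<open>F_bar\<close> is countably additive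
  and nonzero, gives another element. Without a normalization on \<open>\<Omega> \<times> {0}\<close> the
  inclusion below would therefore fail for every \<open>\<xi>\<close> that is represented at all. So the inclusion
  is required of the representing elements that do not charge \<open>\<Omega> \<times> {0}\<close>. No such condition is
  needed in \<^const>\<open>frakS_uc\<close>, because dropping the mass on \<open>\<Omega> \<times> {0}\<close> from an element of
  \<^const>\<open>frakM_uc\<close> preserves countable additivity on \<^const>\<open>F_bar\<close>.
\<close>

definition frakS_up :: "'a set \<Rightarrow> (real \<Rightarrow> 'a set set) \<Rightarrow> (real \<Rightarrow> 'a set \<Rightarrow> real) set" where
  "frakS_up \<Omega> A =
     {\<xi> \<in> frakS A. xi_inf A \<xi> \<in> pfa (union_alg A) \<and>
        {x \<in> frakM_of \<Omega> A \<xi>. x (\<Omega> \<times> {0}) = 0} \<subseteq> frakM_up \<Omega> A}"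

end

theory Submission
  imports Defs
begin

text \<open>
  The difference \<open>\<pi>\<close> between a supermartingale \<open>\<xi>\<close> and its limit \<open>\<xi>\<^sub>\<infinity>\<close> is a potential: it decreases to
  \<open>0\<close>. On the limit the decomposition is that of Yosida and Hewitt, which is derived here from
  two facts about an algebra: the countably additive set functions form a solid subspace
  (\<open>ca_solid\<close>, \<open>ca_abs\<close>), and they are stable under suprema of bounded upward directed families
  of positive elements (\<open>directed_SUP\<close>). The potential has to be decomposed through its
  representations as masses \<open>x (F \<times> {t<..})\<close>, of which there are many.

  Representations are produced by compactness of the positive additive set functions of bounded
  mass on a power set, in place of the Hahn-Banach theorem. It yields extensions from an algebra
  to all subsets, also below a given set function (\<open>extension_exists\<close>,
  \<open>dominated_extension_exists\<close>), and it reduces the construction of a set function on the product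
  to single strips \<open>\<Omega> \<times> {t<..u}\<close> (\<open>strip_gluing\<close>), where only the algebra \<open>A t\<close> matters. In
  particular every potential has a representation (\<open>potential_representation\<close>).

  Existence. By Zorn's lemma there is a maximal \<open>s\<close> among the set functions that are countably
  additive on \<open>F_bar\<close> and whose potential can be subtracted from \<open>\<pi>\<close> leaving a potential. If
  some representation \<open>y\<close> of the remainder had a countably additive part on \<open>F_bar\<close>, this part
  could be extended to all sets below \<open>y\<close> and added to \<open>s\<close>. So all representations of the remainder
  that do not charge \<open>\<Omega> \<times> {0}\<close> are purely finitely additive (\<open>remainder_is_up\<close>).

  Uniqueness. Let \<open>\<zeta>1 + \<eta>1 = \<zeta>2 + \<eta>2\<close> be two decompositions. The limits split uniquely by
  Yosida and Hewitt. If \<open>z1\<close>, \<open>z2\<close> and \<open>w2\<close> represent \<open>\<zeta>1\<close>, \<open>\<zeta>2\<close> and \<open>\<eta>2\<close>, then some \<open>x \<le> z1\<close>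
  satisfies \<open>z1 - z2 \<le> x \<le> w2\<close> on all rectangles \<open>F \<times> {t<..u}\<close> with \<open>F \<in> A t\<close>
  (\<open>common_part_exists\<close>). Then \<open>x\<close> is countably additive on \<open>F_bar\<close>, and since the
  potential of \<open>w2 - x\<close> has a representation too, \<open>x\<close> is a summand of a representation of \<open>\<eta>2\<close>, hence
  purely finitely additive. So \<open>x = 0\<close>, that is \<open>\<zeta>1 \<le> \<zeta>2\<close>, and equality follows by symmetry.
\<close>

section \<open>Finitely additive set functions on an algebra\<close>

lemma ba_empty:
  assumes "algebra \<Omega> G" "m \<in> ba G"
  shows "m {} = 0"
proof -
  interpret algebra \<Omega> G by fact
  show ?thesis
    using additiveD[of G m "{}" "{}"] assms(2) by (auto simp: ba_def)
qed

lemma ba_Un: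
  assumes "m \<in> ba G" "E \<in> G" "F \<in> G" "E \<inter> F = {}"
  shows "m (E \<union> F) = m E + m F"
  using additiveD[of G m E F] assms by (auto simp: ba_def)

lemma ba_Diff:
  assumes "algebra \<Omega> G" "m \<in> ba G" "E \<in> G" "F \<in> G" "E \<subseteq> F"
  shows "m (F - E) = m F - m E"
proof -
  interpret algebra \<Omega> G by fact
  have "m (E \<union> (F - E)) = m E + m (F - E)"
    using assms by (intro ba_Un) auto
  moreover have "E \<union> (F - E) = F" using assms by auto
  ultimately show ?thesis by simp
qed

lemma ba_split:
  assumes "algebra \<Omega> G" "m \<in> ba G" "E \<in> G" "F \<in> G"
  shows "m F = m (F \<inter> E) + m (F - E)"
proof -
  interpret algebra \<Omega> G by fact
  show ?thesis
    using ba_Un[OF assms(2), of "F \<inter> E" "F - E"] assms by (auto simp: Int_Diff_Un)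
qed

lemma ba_sum:
  assumes "algebra \<Omega> G" "m \<in> ba G" "finite I" "f ` I \<subseteq> G" "disjoint_family_on f I"
  shows "(\<Sum>i\<in>I. m (f i)) = m (\<Union>i\<in>I. f i)"
proof -
  interpret algebra \<Omega> G by fact
  show ?thesis
    using assms(3-5)
  proof (induction I)
    case empty
    then show ?case using ba_empty[OF assms(1,2)] by simp
  next
    case (insert i I)
    have "m (f i \<union> (\<Union>i\<in>I. f i)) = m (f i) + m (\<Union>i\<in>I. f i)"
      using insert.prems insert.hyps
      by (intro ba_Un[OF assms(2)] finite_UN) (force simp: disjoint_family_on_def)+
    then show ?case
      using insert by (simp add: disjoint_family_on_def)
  qed
qed

lemma ba_pos_D:
  assumes "m \<in> ba_pos G"
  shows "m \<in> ba G" "\<And>F. 0 \<le> m F" "\<And>F. F \<notin> G \<Longrightarrow> m F = 0"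
  using assms unfolding ba_pos_def ba_def by (auto, metis order_refl)

lemma ba_pos_mono:
  assumes "algebra \<Omega> G" "m \<in> ba_pos G" "E \<in> G" "F \<in> G" "E \<subseteq> F"
  shows "m E \<le> m F"
proof -
  have "m (F - E) = m F - m E"
    using assms by (intro ba_Diff[OF assms(1)]) (auto simp: ba_pos_def)
  then show ?thesis using ba_pos_D(2)[OF assms(2), of "F - E"] by simp
qed

lemma ba_pos_I:
  assumes alg: "algebra \<Omega> G"
    and nonneg: "\<And>F. F \<in> G \<Longrightarrow> 0 \<le> m F"
    and add: "\<And>E F. E \<in> G \<Longrightarrow> F \<in> G \<Longrightarrow> E \<inter> F = {} \<Longrightarrow> m (E \<union> F) = m E + m F"
    and zero: "\<And>F. F \<notin> G \<Longrightarrow> m F = 0"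
  shows "m \<in> ba_pos G"
proof -
  interpret algebra \<Omega> G by fact
  have "\<bar>m F\<bar> \<le> m \<Omega>" if F: "F \<in> G" for F
  proof -
    have "m (F \<union> (\<Omega> - F)) = m F + m (\<Omega> - F)"
      using F by (intro add) auto
    moreover have "F \<union> (\<Omega> - F) = \<Omega>" using F sets_into_space by auto
    moreover have "\<Omega> - F \<in> G" using F by auto
    ultimately show ?thesis using nonneg F by fastforce
  qed
  then show ?thesis
    using assms by (auto simp: ba_pos_def ba_def additive_def)
qed

lemma ba_pos_le_space:
  assumes "algebra \<Omega> G" "m \<in> ba_pos G"
  shows "m F \<le> m \<Omega>"
proof -
  interpret algebra \<Omega> G by fact
  show ?thesis
    using ba_pos_mono[OF assms, of F \<Omega>] ba_pos_D(2,3)[OF assms(2)] sets_into_space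
    by (cases "F \<in> G") auto
qed

lemma ba_add:
  assumes "m \<in> ba G" "l \<in> ba G"
  shows "(\<lambda>F. m F + l F) \<in> ba G"
proof -
  obtain c d where "\<And>F. F \<in> G \<Longrightarrow> \<bar>m F\<bar> \<le> c" "\<And>F. F \<in> G \<Longrightarrow> \<bar>l F\<bar> \<le> d"
    using assms unfolding ba_def by blast
  then have "\<exists>c. \<forall>F\<in>G. \<bar>m F + l F\<bar> \<le> c"
    by (intro exI[of _ "c + d"] ballI) (smt (verit))
  then show ?thesis using assms unfolding ba_def additive_def by simp
qed

lemma ba_uminus: "m \<in> ba G \<Longrightarrow> (\<lambda>F. - m F) \<in> ba G"
  unfolding ba_def additive_def by auto

lemma ba_diff:
  assumes "m \<in> ba G" "l \<in> ba G"
  shows "(\<lambda>F. m F - l F) \<in> ba G"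
  using ba_add[OF assms(1) ba_uminus[OF assms(2)]] by simp

lemma ba_zero: "(\<lambda>_. 0) \<in> ba G"
  by (auto simp: ba_def additive_def)

lemma ba_pos_zero: "(\<lambda>_. 0) \<in> ba_pos G"
  by (auto simp: ba_pos_def ba_zero)

lemma ba_pos_add: "m \<in> ba_pos G \<Longrightarrow> l \<in> ba_pos G \<Longrightarrow> (\<lambda>F. m F + l F) \<in> ba_pos G"
  by (auto simp: ba_pos_def ba_add)

lemma ba_eqI:
  assumes "m \<in> ba G" "l \<in> ba G" "\<And>F. F \<in> G \<Longrightarrow> m F = l F"
  shows "m = l"
  using assms by (auto simp: ba_def fun_eq_iff) metis

lemma ba_pos_eq_zero:
  assumes "algebra \<Omega> G" "m \<in> ba_pos G" "m \<Omega> = 0"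
  shows "m = (\<lambda>_. 0)"
proof
  show "m F = 0" for F
    using ba_pos_le_space[OF assms(1,2), of F] ba_pos_D(2)[OF assms(2), of F] assms(3) by simp
qed

text \<open>
  The sums in the total variation norm split into a sum over the members of positive and one over
  the members of negative mass, and each is the mass of a single set. Hence a uniform bound on a
  family of set functions is the same as a bound on their norms.
\<close>

lemma ba_norm_le:
  assumes alg: "algebra \<Omega> G" and m: "m \<in> ba G" and c: "\<And>F. F \<in> G \<Longrightarrow> \<bar>m F\<bar> \<le> c"
  shows "ba_norm G m \<le> ereal (2 * c)"
  unfolding ba_norm_def
proof (rule SUP_least, clarsimp)
  interpret algebra \<Omega> G by fact
  fix P assume P: "finite P" "P \<subseteq> G" "disjoint P"
  have one: "\<bar>\<Sum>F\<in>Q. m F\<bar> \<le> c" if "Q \<subseteq> P" for Q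
  proof -
    have fin: "finite Q" using that P(1) finite_subset by auto
    have "(\<Sum>F\<in>Q. m F) = m (\<Union>F\<in>Q. F)"
      using P that fin by (intro ba_sum[OF alg m]) (auto simp: disjoint_family_on_def disjoint_def)
    moreover have "(\<Union>F\<in>Q. F) \<in> G" using fin that P by (auto intro!: finite_Union)
    ultimately show ?thesis using c by auto
  qed
  have "(\<Sum>F\<in>P. \<bar>m F\<bar>) = (\<Sum>F\<in>{F\<in>P. 0 \<le> m F}. m F) - (\<Sum>F\<in>{F\<in>P. \<not> 0 \<le> m F}. m F)"
    using P(1) by (simp add: sum.inter_filter flip: sum_subtractf)
      (auto intro!: sum.cong)
  then show "(\<Sum>F\<in>P. \<bar>m F\<bar>) \<le> 2 * c"
    using one[of "{F\<in>P. 0 \<le> m F}"] one[of "{F\<in>P. \<not> 0 \<le> m F}"] by auto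
qed

lemma le_ba_norm:
  assumes "F \<in> G"
  shows "ereal \<bar>m F\<bar> \<le> ba_norm G m"
  unfolding ba_norm_def
  by (rule SUP_upper2[of "{F}"]) (use assms in \<open>auto simp: disjoint_def\<close>)

section \<open>Countably additive and purely finitely additive set functions\<close>

lemma ca_D: "m \<in> ca G \<Longrightarrow> m \<in> ba G"
  by (simp add: ca_def)

lemma ca_sums:
  assumes "m \<in> ca G" "range f \<subseteq> G" "disjoint_family f" "(\<Union>i. f i) \<in> G"
  shows "(\<lambda>i. m (f i)) sums m (\<Union>i. f i)"
  using assms by (simp add: ca_def)

lemma ca_add: "m \<in> ca G \<Longrightarrow> l \<in> ca G \<Longrightarrow> (\<lambda>F. m F + l F) \<in> ca G"
  unfolding ca_def by (auto intro!: ba_add sums_add)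

lemma ca_uminus: "m \<in> ca G \<Longrightarrow> (\<lambda>F. - m F) \<in> ca G"
  unfolding ca_def by (auto intro!: ba_uminus sums_minus)

lemma ca_diff: "m \<in> ca G \<Longrightarrow> l \<in> ca G \<Longrightarrow> (\<lambda>F. m F - l F) \<in> ca G"
  using ca_add[OF _ ca_uminus] by force

lemma ca_zero: "(\<lambda>_. 0) \<in> ca G"
  by (auto simp: ca_def ba_zero)

text \<open>
  For a positive additive set function the partial sums over a disjoint sequence never exceed the
  mass of the union, so countable additivity is only the opposite inequality. In this form it is
  visibly inherited by suprema and by smaller set functions.
\<close>

lemma ca_iff:
  assumes alg: "algebra \<Omega> G" and m: "m \<in> ba_pos G"
  shows "m \<in> ca G \<longleftrightarrow>
    (\<forall>(f :: nat \<Rightarrow> _) b. range f \<subseteq> G \<longrightarrow> disjoint_family f \<longrightarrow> (\<Union>i. f i) \<in> G \<longrightarrow>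
      (\<forall>n. (\<Sum>i<n. m (f i)) \<le> b) \<longrightarrow> m (\<Union>i. f i) \<le> b)"
    (is "_ = ?R")
proof
  assume "m \<in> ca G"
  then have "(\<lambda>n. \<Sum>i<n. m (f i)) \<longlonglongrightarrow> m (\<Union>i. f i)"
    if "range f \<subseteq> G" "disjoint_family f" "(\<Union>i. f i) \<in> G" for f :: "nat \<Rightarrow> _"
    using ca_sums[OF _ that] by (simp add: sums_def)
  then show ?R by (meson LIMSEQ_le_const2)
next
  assume R: ?R
  interpret algebra \<Omega> G by fact
  have "(\<lambda>i. m (f i)) sums m (\<Union>i. f i)"
    if f: "range f \<subseteq> G" "disjoint_family f" "(\<Union>i. f i) \<in> G" for f :: "nat \<Rightarrow> _"
  proof -
    have le: "(\<Sum>i<n. m (f i)) \<le> m (\<Union>i. f i)" for n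
    proof -
      have "(\<Sum>i<n. m (f i)) = m (\<Union>i<n. f i)"
        using f ba_pos_D[OF m]
        by (intro ba_sum[OF alg]) (auto simp: disjoint_family_on_def)
      also have "\<dots> \<le> m (\<Union>i. f i)"
        using f by (intro ba_pos_mono[OF alg m _ f(3)] finite_UN) auto
      finally show ?thesis .
    qed
    have s: "summable (\<lambda>i. m (f i))"
      using le ba_pos_D(2)[OF m] by (intro summableI_nonneg_bounded)
    have "m (\<Union>i. f i) \<le> suminf (\<lambda>i. m (f i))"
      using R f sum_le_suminf[OF s] ba_pos_D(2)[OF m] by blast
    moreover have "suminf (\<lambda>i. m (f i)) \<le> m (\<Union>i. f i)"
      using suminf_le_const[OF s le] .
    ultimately show ?thesis using summable_sums[OF s] by (metis antisym)
  qed
  then show "m \<in> ca G"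
    using ba_pos_D[OF m] unfolding ca_def by blast
qed

text \<open>
  Along a disjoint sequence the mass that \<open>k\<close> gives to the rest of the union is at most that of
  \<open>l\<close>, which tends to \<open>0\<close>.
\<close>

lemma ca_solid:
  assumes alg: "algebra \<Omega> G" and k: "k \<in> ba_pos G" and l: "l \<in> ca G"
    and le: "\<And>F. F \<in> G \<Longrightarrow> k F \<le> l F"
  shows "k \<in> ca G"
  unfolding ca_iff[OF alg k]
proof (intro allI impI)
  interpret algebra \<Omega> G by fact
  fix f :: "nat \<Rightarrow> _" and b
  assume f: "range f \<subseteq> G" "disjoint_family f" "(\<Union>i. f i) \<in> G"
    and b: "\<forall>n. (\<Sum>i<n. k (f i)) \<le> b"
  have fin: "(\<Union>i<n. f i) \<in> G" for n using f by (intro finite_UN) auto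
  have part: "(\<Sum>i<n. m (f i)) = m (\<Union>i<n. f i)" if "m \<in> ba G" for m n
    using f that by (intro ba_sum[OF alg]) (auto simp: disjoint_family_on_def)
  have "k (\<Union>i. f i) \<le> b + (l (\<Union>i. f i) - (\<Sum>i<n. l (f i)))" for n
  proof -
    have "k (\<Union>i. f i) - k (\<Union>i<n. f i) = k ((\<Union>i. f i) - (\<Union>i<n. f i))"
      by (intro ba_Diff[OF alg, symmetric] ba_pos_D(1)[OF k] f(3) fin) auto
    also have "\<dots> \<le> l ((\<Union>i. f i) - (\<Union>i<n. f i))"
      using f(3) fin by (intro le) auto
    also have "\<dots> = l (\<Union>i. f i) - l (\<Union>i<n. f i)"
      by (intro ba_Diff[OF alg] ca_D[OF l] f(3) fin) auto
    finally show ?thesis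
      using b[rule_format, of n] part[OF ba_pos_D(1)[OF k], of n] part[OF ca_D[OF l], of n] by simp
  qed
  moreover have "(\<lambda>n. b + (l (\<Union>i. f i) - (\<Sum>i<n. l (f i)))) \<longlonglongrightarrow>
      b + (l (\<Union>i. f i) - l (\<Union>i. f i))"
    using l f by (intro tendsto_intros) (auto simp: ca_def sums_def)
  ultimately show "k (\<Union>i. f i) \<le> b"
    by (intro LIMSEQ_le_const) auto
qed

lemma ba_sup_D:
  assumes "algebra \<Omega> G" "m \<in> ba G" "l \<in> ba G"
  shows "ba_sup G m l \<in> ba G"
    and "\<And>F. F \<in> G \<Longrightarrow> m F \<le> ba_sup G m l F"
    and "\<And>F. F \<in> G \<Longrightarrow> l F \<le> ba_sup G m l F"
    and "\<And>u F. u \<in> ba G \<Longrightarrow> (\<And>E. E \<in> G \<Longrightarrow> m E \<le> u E) \<Longrightarrow> (\<And>E. E \<in> G \<Longrightarrow> l E \<le> u E) \<Longrightarrow>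
        F \<in> G \<Longrightarrow> ba_sup G m l F \<le> u F"
  using is_ba_sup_ba_sup[OF assms] by (auto simp: is_ba_sup_def ba_le_def)

lemma ba_inf_D:
  assumes "algebra \<Omega> G" "m \<in> ba G" "l \<in> ba G"
  shows "ba_inf G m l \<in> ba G"
    and "\<And>F. F \<in> G \<Longrightarrow> ba_inf G m l F \<le> m F"
    and "\<And>F. F \<in> G \<Longrightarrow> ba_inf G m l F \<le> l F"
    and "\<And>u F. u \<in> ba G \<Longrightarrow> (\<And>E. E \<in> G \<Longrightarrow> u E \<le> m E) \<Longrightarrow> (\<And>E. E \<in> G \<Longrightarrow> u E \<le> l E) \<Longrightarrow>
        F \<in> G \<Longrightarrow> u F \<le> ba_inf G m l F"
proof -
  note s = ba_sup_D[OF assms(1) ba_uminus[OF assms(2)] ba_uminus[OF assms(3)]]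
  show "ba_inf G m l \<in> ba G" unfolding ba_inf_def by (intro ba_uminus s)
  show "ba_inf G m l F \<le> m F" "ba_inf G m l F \<le> l F" if "F \<in> G" for F
    using s(2,3)[OF that] by (auto simp: ba_inf_def)
  show "u F \<le> ba_inf G m l F"
    if "u \<in> ba G" "\<And>E. E \<in> G \<Longrightarrow> u E \<le> m E" "\<And>E. E \<in> G \<Longrightarrow> u E \<le> l E" "F \<in> G" for u F
    using s(4)[OF ba_uminus[OF that(1)] _ _ that(4)] that by (simp add: ba_inf_def)
qed

lemma ba_abs_D:
  assumes "algebra \<Omega> G" "m \<in> ba G"
  shows "ba_abs G m \<in> ba_pos G"
    and "\<And>F. F \<in> G \<Longrightarrow> m F \<le> ba_abs G m F"
    and "\<And>F. F \<in> G \<Longrightarrow> - m F \<le> ba_abs G m F"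
    and "\<And>u F. u \<in> ba G \<Longrightarrow> (\<And>E. E \<in> G \<Longrightarrow> m E \<le> u E) \<Longrightarrow> (\<And>E. E \<in> G \<Longrightarrow> - m E \<le> u E) \<Longrightarrow>
        F \<in> G \<Longrightarrow> ba_abs G m F \<le> u F"
proof -
  note s = ba_sup_D[OF assms ba_uminus[OF assms(2)], folded ba_abs_def]
  show le: "m F \<le> ba_abs G m F" "- m F \<le> ba_abs G m F" if "F \<in> G" for F
    using s(2,3)[OF that] .
  show "ba_abs G m \<in> ba_pos G"
    using s(1) le by (fastforce simp: ba_pos_def)
  show "ba_abs G m F \<le> u F"
    if "u \<in> ba G" "\<And>E. E \<in> G \<Longrightarrow> m E \<le> u E" "\<And>E. E \<in> G \<Longrightarrow> - m E \<le> u E" "F \<in> G" for u F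
    using s(4) that by blast
qed

lemma ba_abs_pos:
  assumes "algebra \<Omega> G" "m \<in> ba_pos G"
  shows "ba_abs G m = m"
proof (rule ba_eqI)
  note m = ba_pos_D[OF assms(2)]
  note a = ba_abs_D[OF assms(1) m(1)]
  show "ba_abs G m \<in> ba G" using a(1) by (rule ba_pos_D)
  show "m \<in> ba G" by (rule m)
  show "ba_abs G m F = m F" if "F \<in> G" for F
    using a(2)[OF that] a(4)[OF m(1) _ _ that] m(2) by (smt (verit))
qed

lemma ba_abs_le:
  assumes alg: "algebra \<Omega> G" and m: "m \<in> ba G" and F: "F \<in> G"
    and b: "\<And>E. E \<in> G \<Longrightarrow> E \<subseteq> F \<Longrightarrow> m E - m (F - E) \<le> b"
  shows "ba_abs G m F \<le> b"
proof -
  interpret algebra \<Omega> G by fact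
  have "ba_abs G m = (\<lambda>F. if F \<in> G then (SUP E \<in> {E\<in>G. E \<subseteq> F}. m E + - m (F - E)) else 0)"
    unfolding ba_abs_def
    by (rule is_ba_sup_unique[OF is_ba_sup_ba_sup[OF alg m ba_uminus[OF m]]
          is_ba_sup_formula[OF alg m ba_uminus[OF m]]])
  moreover have "(SUP E \<in> {E\<in>G. E \<subseteq> F}. m E + - m (F - E)) \<le> b"
    using b by (intro cSUP_least) auto
  ultimately show ?thesis using F by simp
qed

text \<open>
  For \<open>E\<close> inside the union of the \<open>f i\<close>, the number \<open>l E - l (\<Union> f - E)\<close> is the sum of the
  corresponding numbers for the \<open>f i\<close>, and each of these is at most the variation of \<open>l\<close> on \<open>f i\<close>.
\<close>

lemma ca_abs:
  assumes alg: "algebra \<Omega> G" and l: "l \<in> ca G"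
  shows "ba_abs G l \<in> ca G"
proof -
  interpret algebra \<Omega> G by fact
  note a = ba_abs_D[OF alg ca_D[OF l]]
  show ?thesis
    unfolding ca_iff[OF alg a(1)]
  proof (intro allI impI)
    fix f :: "nat \<Rightarrow> _" and b
    assume f: "range f \<subseteq> G" "disjoint_family f" "(\<Union>i. f i) \<in> G"
      and b: "\<forall>n. (\<Sum>i<n. ba_abs G l (f i)) \<le> b"
    show "ba_abs G l (\<Union>i. f i) \<le> b"
    proof (rule ba_abs_le[OF alg ca_D[OF l] f(3)])
      fix E assume E: "E \<in> G" "E \<subseteq> (\<Union>i. f i)"
      have sums: "(\<lambda>i. l (f i \<inter> H)) sums l H" if H: "H \<in> G" "H \<subseteq> (\<Union>i. f i)" for H
      proof -
        have "(\<Union>i. f i \<inter> H) = H" using H by auto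
        moreover have "range (\<lambda>i. f i \<inter> H) \<subseteq> G" using f H by auto
        moreover have "disjoint_family (\<lambda>i. f i \<inter> H)"
          using f(2) by (auto simp: disjoint_family_on_def)
        ultimately show ?thesis
          using ca_sums[OF l, of "\<lambda>i. f i \<inter> H"] H(1) by simp
      qed
      have D: "(\<Union>i. f i) - E \<in> G" using f E by auto
      have "(\<lambda>i. l (f i \<inter> E) - l (f i \<inter> ((\<Union>i. f i) - E))) sums (l E - l ((\<Union>i. f i) - E))"
        by (intro sums_diff sums E D) auto
      moreover have "(\<Sum>i<n. l (f i \<inter> E) - l (f i \<inter> ((\<Union>i. f i) - E))) \<le> b" for n
      proof -
        have "l (f i \<inter> E) - l (f i \<inter> ((\<Union>i. f i) - E)) \<le> ba_abs G l (f i)" for i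
        proof -
          have fi: "f i \<in> G" using f by auto
          have "f i \<inter> ((\<Union>i. f i) - E) = f i - E" by auto
          moreover have "l (f i \<inter> E) \<le> ba_abs G l (f i \<inter> E)" "- l (f i - E) \<le> ba_abs G l (f i - E)"
            using a(2,3) fi E by auto
          moreover have "ba_abs G l (f i) = ba_abs G l (f i \<inter> E) + ba_abs G l (f i - E)"
            by (rule ba_split[OF alg ba_pos_D(1)[OF a(1)] E(1) fi])
          ultimately show ?thesis by simp
        qed
        then show ?thesis using b by (meson order_trans sum_mono)
      qed
      ultimately show "l E - l ((\<Union>i. f i) - E) \<le> b"
        unfolding sums_def by (intro LIMSEQ_le_const2) auto
    qed
  qed
qed

text \<open>
  Orthogonality to the solid subspace of countably additive set functions says that no nonzero one
  of them fits below the modulus.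
\<close>

lemma pfa_iff:
  assumes alg: "algebra \<Omega> G"
  shows "p \<in> pfa G \<longleftrightarrow> p \<in> ba G \<and>
    (\<forall>k\<in>ca G. k \<in> ba_pos G \<longrightarrow> (\<forall>F\<in>G. k F \<le> ba_abs G p F) \<longrightarrow> k = (\<lambda>_. 0))"
    (is "_ \<longleftrightarrow> _ \<and> ?R")
proof (cases "p \<in> ba G")
  case True
  note p = ba_abs_D[OF alg True]
  have "ba_inf G (ba_abs G p) (ba_abs G l) = (\<lambda>_. 0)" if R: ?R and l: "l \<in> ca G" for l
  proof -
    note la = ba_abs_D[OF alg ca_D[OF l]]
    note i = ba_inf_D[OF alg ba_pos_D(1)[OF p(1)] ba_pos_D(1)[OF la(1)]]
    have pos: "ba_inf G (ba_abs G p) (ba_abs G l) \<in> ba_pos G"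
      using i(4)[OF ba_zero] ba_pos_D(2)[OF p(1)] ba_pos_D(2)[OF la(1)] i(1)
      by (auto simp: ba_pos_def)
    moreover have "ba_inf G (ba_abs G p) (ba_abs G l) \<in> ca G"
      using ca_solid[OF alg pos ca_abs[OF alg l]] i(3) by blast
    ultimately show ?thesis using R i(2) by blast
  qed
  moreover have "k = (\<lambda>_. 0)"
    if pfa: "p \<in> pfa G" and k: "k \<in> ca G" "k \<in> ba_pos G" "\<forall>F\<in>G. k F \<le> ba_abs G p F" for k
  proof -
    have "ba_inf G (ba_abs G p) k = (\<lambda>_. 0)"
      using pfa k(1) ba_abs_pos[OF alg k(2)] unfolding pfa_def by fastforce
    then have "k F \<le> 0" if "F \<in> G" for F
      using ba_inf_D(4)[OF alg ba_pos_D(1)[OF p(1)] ca_D[OF k(1)] ca_D[OF k(1)] _ _ that] k(3)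
      by auto
    then show ?thesis
      using ba_pos_D[OF k(2)] by (auto simp: fun_eq_iff) (metis antisym)
  qed
  ultimately show ?thesis using True unfolding pfa_def by blast
qed (auto simp: pfa_def)

text \<open>
  A positive countably additive set function below \<open>\<bar>p\<bar> + \<bar>q\<bar>\<close> has infimum \<open>0\<close> with \<open>\<bar>p\<bar>\<close>, so it
  lies below \<open>\<bar>q\<bar>\<close> alone.
\<close>

lemma pfa_diff:
  assumes alg: "algebra \<Omega> G" and p: "p \<in> pfa G" and q: "q \<in> pfa G"
  shows "(\<lambda>F. p F - q F) \<in> pfa G"
proof -
  note pq = p[unfolded pfa_iff[OF alg]] q[unfolded pfa_iff[OF alg]]
  have d: "(\<lambda>F. p F - q F) \<in> ba G" using pq ba_diff by blast
  note pa = ba_abs_D[OF alg conjunct1[OF pq(1)]]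
  note qa = ba_abs_D[OF alg conjunct1[OF pq(2)]]
  have le: "ba_abs G (\<lambda>F. p F - q F) F \<le> ba_abs G p F + ba_abs G q F" if "F \<in> G" for F
  proof (rule ba_abs_D(4)[OF alg d ba_add _ _ that])
    show "ba_abs G p \<in> ba G" "ba_abs G q \<in> ba G" using pa(1) qa(1) by (auto dest: ba_pos_D(1))
    show "p E - q E \<le> ba_abs G p E + ba_abs G q E" "- (p E - q E) \<le> ba_abs G p E + ba_abs G q E"
      if "E \<in> G" for E
      using pa(2,3)[OF that] qa(2,3)[OF that] by linarith+
  qed
  have "k = (\<lambda>_. 0)"
    if k: "k \<in> ca G" "k \<in> ba_pos G" "\<forall>F\<in>G. k F \<le> ba_abs G (\<lambda>F. p F - q F) F" for k
  proof -
    \<comment> \<open>\<open>k - \<bar>q\<bar>\<close> is below both \<open>k\<close> and \<open>\<bar>p\<bar>\<close>, hence below their infimum \<open>h\<close>, which vanishes.\<close>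
    define h where "h = ba_inf G k (ba_abs G p)"
    note i = ba_inf_D[OF alg ca_D[OF k(1)] ba_pos_D(1)[OF pa(1)], folded h_def]
    have h: "h \<in> ba_pos G"
      using i(1) i(4)[OF ba_zero] ba_pos_D(2)[OF k(2)] ba_pos_D(2)[OF pa(1)]
      by (auto simp: ba_pos_def)
    then have "h \<in> ca G" using ca_solid[OF alg h k(1)] i(2) by blast
    then have h0: "h = (\<lambda>_. 0)" using pq h i(3) by blast
    have "k F \<le> ba_abs G q F" if F: "F \<in> G" for F
    proof -
      have "(\<lambda>E. k E - ba_abs G q E) \<in> ba G"
        by (intro ba_diff ca_D[OF k(1)] ba_pos_D(1)[OF qa(1)])
      moreover have "k E - ba_abs G q E \<le> k E" "k E - ba_abs G q E \<le> ba_abs G p E" if "E \<in> G" for E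
        using ba_pos_D(2)[OF qa(1), of E] k(3) le that by fastforce+
      ultimately show ?thesis using i(4)[OF _ _ _ F] h0 by fastforce
    qed
    then show ?thesis using pq k by blast
  qed
  then show ?thesis using d unfolding pfa_iff[OF alg] by blast
qed

lemma ca_Int_pfa:
  assumes alg: "algebra \<Omega> G" and m: "m \<in> ca G" "m \<in> pfa G"
  shows "m = (\<lambda>_. 0)"
proof -
  note a = ba_abs_D[OF alg ca_D[OF m(1)]]
  have "ba_abs G m = (\<lambda>_. 0)"
    using m(2) ca_abs[OF alg m(1)] a(1) unfolding pfa_iff[OF alg] by blast
  then show ?thesis
    using a(2,3) ca_D[OF m(1)] by (intro ba_eqI[OF _ ba_zero]) (auto intro: antisym)
qed

lemma Yosida_Hewitt_unique:
  assumes alg: "algebra \<Omega> G" and c: "c \<in> ca G" "c' \<in> ca G" and p: "p \<in> pfa G" "p' \<in> pfa G"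
    and eq: "\<And>F. F \<in> G \<Longrightarrow> c F + p F = c' F + p' F"
  shows "c = c'" "p = p'"
proof -
  have ba: "c \<in> ba G" "c' \<in> ba G" "p \<in> ba G" "p' \<in> ba G"
    using c p by (auto simp: ca_D pfa_def)
  have "(\<lambda>F. c F - c' F) = (\<lambda>F. p' F - p F)"
    using eq by (intro ba_eqI[of _ G] ba_diff ba) (auto simp: algebra_simps)
  then have "(\<lambda>F. c F - c' F) = (\<lambda>_. 0)"
    using ca_Int_pfa[OF alg ca_diff[OF c]] pfa_diff[OF alg p(2,1)] by simp
  then show "c = c'" by (auto simp: fun_eq_iff)
  then show "p = p'" using eq by (intro ba_eqI[OF ba(3,4)]) auto
qed

text \<open>
  Upward directed suprema may be taken setwise: additivity survives because two members that nearly
  attain the supremum on two disjoint sets have a common majorant. Countable additivity survives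
  because suprema commute with the inequality of \<open>ca_iff\<close>.
\<close>

lemma directed_SUP:
  assumes alg: "algebra \<Omega> G" and ne: "D \<noteq> {}" and D: "D \<subseteq> ba_pos G"
    and bd: "\<forall>l\<in>D. l \<Omega> \<le> M"
    and dir: "\<forall>k\<in>D. \<forall>l\<in>D. \<exists>n\<in>D. \<forall>F\<in>G. k F \<le> n F \<and> l F \<le> n F"
  shows "\<And>l F. l \<in> D \<Longrightarrow> l F \<le> (SUP l\<in>D. l F)"
    and "(\<lambda>F. SUP l\<in>D. l F) \<in> ba_pos G"
    and "D \<subseteq> ca G \<Longrightarrow> (\<lambda>F. SUP l\<in>D. l F) \<in> ca G"
proof -
  interpret algebra \<Omega> G by fact
  define s where "s = (\<lambda>F. SUP l\<in>D. l F)"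
  have pos: "l \<in> ba_pos G" if "l \<in> D" for l using D that by auto
  have "l F \<le> M" if "l \<in> D" for l F
    using ba_pos_le_space[OF alg pos[OF that], of F] bd that by fastforce
  then have bdd: "bdd_above ((\<lambda>l. l F) ` D)" for F
    by (intro bdd_aboveI[of _ M]) auto
  show up: "l F \<le> (SUP l\<in>D. l F)" if "l \<in> D" for l F
    using bdd that by (rule cSUP_upper2) simp
  then have up': "l F \<le> s F" if "l \<in> D" for l F using that by (simp add: s_def)
  have least: "s F \<le> b" if "\<And>l. l \<in> D \<Longrightarrow> l F \<le> b" for F b
    unfolding s_def using ne that by (intro cSUP_least) auto
  \<comment> \<open>Directedness lets one member nearly attain the suprema at finitely many sets simultaneously.\<close>
  have sum_le: "(\<Sum>i<n. s (g i)) \<le> b"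
    if "\<And>l. l \<in> D \<Longrightarrow> (\<Sum>i<n. l (g i)) \<le> b" "\<And>i. i < n \<Longrightarrow> g i \<in> G"
    for n :: nat and g b
    using that
  proof (induction n arbitrary: b)
    case 0
    then show ?case using ne by auto
  next
    case (Suc n)
    have "(\<Sum>i<n. s (g i)) \<le> b - s (g n)"
    proof (rule Suc.IH)
      fix l assume l: "l \<in> D"
      have "s (g n) \<le> b - (\<Sum>i<n. l (g i))"
      proof (rule least)
        fix k assume "k \<in> D"
        then obtain h where h: "h \<in> D" "\<And>F. F \<in> G \<Longrightarrow> k F \<le> h F" "\<And>F. F \<in> G \<Longrightarrow> l F \<le> h F"
          using dir l by blast
        have "(\<Sum>i<n. l (g i)) \<le> (\<Sum>i<n. h (g i))"
          using h(3) Suc.prems(2) by (intro sum_mono) auto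
        then show "k (g n) \<le> b - (\<Sum>i<n. l (g i))"
          using Suc.prems(1)[OF h(1)] h(2)[of "g n"] Suc.prems(2)[of n] by auto
      qed
      then show "(\<Sum>i<n. l (g i)) \<le> b - s (g n)" by simp
    qed (use Suc.prems in auto)
    then show ?case by simp
  qed
  have "s \<in> ba_pos G"
  proof (rule ba_pos_I[OF alg])
    obtain l where l: "l \<in> D" using ne by auto
    show "0 \<le> s F" for F
      using up'[OF l, of F] ba_pos_D(2)[OF pos[OF l], of F] by simp
    show "s F = 0" if "F \<notin> G" for F
    proof (rule antisym[OF _ \<open>\<And>F. 0 \<le> s F\<close>])
      have "l F \<le> 0" if "l \<in> D" for l
        using ba_pos_D(3)[OF pos[OF that] \<open>F \<notin> G\<close>] by simp
      then show "s F \<le> 0" by (rule least)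
    qed
    show "s (E \<union> F) = s E + s F" if EF: "E \<in> G" "F \<in> G" "E \<inter> F = {}" for E F
    proof (rule antisym)
      have add: "l (E \<union> F) = l E + l F" if "l \<in> D" for l
        using ba_Un[OF ba_pos_D(1)[OF pos[OF that]] EF] .
      show "s (E \<union> F) \<le> s E + s F"
      proof (rule least)
        show "l (E \<union> F) \<le> s E + s F" if "l \<in> D" for l
          using add[OF that] up'[OF that, of E] up'[OF that, of F] by simp
      qed
      define g where "g i = (if i = (0::nat) then E else F)" for i
      have "(\<Sum>i<2. s (g i)) \<le> s (E \<union> F)"
      proof (rule sum_le)
        show "(\<Sum>i<2. l (g i)) \<le> s (E \<union> F)" if "l \<in> D" for l
          using add[OF that] up'[OF that, of "E \<union> F"] by (simp add: g_def numeral_2_eq_2)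
      qed (use EF in \<open>auto simp: g_def\<close>)
      then show "s E + s F \<le> s (E \<union> F)" by (simp add: g_def numeral_2_eq_2)
    qed
  qed
  then show spos: "(\<lambda>F. SUP l\<in>D. l F) \<in> ba_pos G" unfolding s_def .
  show "(\<lambda>F. SUP l\<in>D. l F) \<in> ca G" if ca: "D \<subseteq> ca G"
    unfolding ca_iff[OF alg spos]
  proof (intro allI impI)
    fix f :: "nat \<Rightarrow> _" and b
    assume f: "range f \<subseteq> G" "disjoint_family f" "(\<Union>i. f i) \<in> G" and b: "\<forall>n. (\<Sum>i<n. (SUP l\<in>D. l (f i))) \<le> b"
    show "(SUP l\<in>D. l (\<Union>i. f i)) \<le> b"
    proof (rule cSUP_least[OF ne])
      fix l assume l: "l \<in> D"
      have "(\<Sum>i<n. l (f i)) \<le> b" for n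
        using b up[OF l] by (meson order_trans sum_mono)
      then show "l (\<Union>i. f i) \<le> b"
        using ca l f ca_iff[OF alg pos[OF l]] by blast
    qed
  qed
qed

text \<open>
  The countably additive part is the supremum of all countably additive set functions between
  \<open>0\<close> and \<open>m\<close>; these are directed because \<open>sup k l \<le> k + l\<close>. A countably additive set
  function below the rest could be added to this supremum, so it is \<open>0\<close>.
\<close>

theorem Yosida_Hewitt_pos:
  assumes alg: "algebra \<Omega> G" and m: "m \<in> ba_pos G"
  obtains c where "c \<in> ca G" "c \<in> ba_pos G" "\<And>F. F \<in> G \<Longrightarrow> c F \<le> m F"
    "(\<lambda>F. m F - c F) \<in> pfa G"
proof -
  interpret algebra \<Omega> G by fact
  define D where "D = {l \<in> ca G. l \<in> ba_pos G \<and> (\<forall>F\<in>G. l F \<le> m F)}"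
  define c where "c = (\<lambda>F. SUP l\<in>D. l F)"
  have zero: "(\<lambda>_. 0) \<in> D" using ba_pos_D(2)[OF m] by (auto simp: D_def ca_zero ba_pos_zero)
  have dir: "\<forall>k\<in>D. \<forall>l\<in>D. \<exists>n\<in>D. \<forall>F\<in>G. k F \<le> n F \<and> l F \<le> n F"
  proof (intro ballI)
    fix k l assume kl: "k \<in> D" "l \<in> D"
    have k: "k \<in> ca G" "k \<in> ba_pos G" "\<And>F. F \<in> G \<Longrightarrow> k F \<le> m F"
      and l: "l \<in> ca G" "l \<in> ba_pos G" "\<And>F. F \<in> G \<Longrightarrow> l F \<le> m F"
      using kl by (auto simp: D_def)
    note s = ba_sup_D[OF alg ca_D[OF k(1)] ca_D[OF l(1)]]
    have pos: "ba_sup G k l \<in> ba_pos G"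
      using s(1,2) ba_pos_D(2)[OF k(2)] by (fastforce simp: ba_pos_def intro: order_trans)
    have "ba_sup G k l F \<le> k F + l F" if "F \<in> G" for F
      using s(4)[OF ba_add[OF ca_D[OF k(1)] ca_D[OF l(1)]] _ _ that]
        ba_pos_D(2)[OF k(2)] ba_pos_D(2)[OF l(2)] by simp
    then have "ba_sup G k l \<in> ca G"
      by (intro ca_solid[OF alg pos ca_add[OF k(1) l(1)]])
    moreover have "\<forall>F\<in>G. ba_sup G k l F \<le> m F"
      using s(4)[OF ba_pos_D(1)[OF m]] k l by blast
    ultimately show "\<exists>n\<in>D. \<forall>F\<in>G. k F \<le> n F \<and> l F \<le> n F"
      using pos s(2,3) by (auto simp: D_def)
  qed
  have ne: "D \<noteq> {}" and sub: "D \<subseteq> ba_pos G" and bd: "\<forall>l\<in>D. l \<Omega> \<le> m \<Omega>"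
    using zero by (auto simp: D_def)
  have S1: "l F \<le> c F" if "l \<in> D" for l F
    unfolding c_def using directed_SUP(1)[OF alg ne sub bd dir that] .
  have S2: "c \<in> ba_pos G"
    unfolding c_def using directed_SUP(2)[OF alg ne sub bd dir] .
  have ca: "c \<in> ca G" 
    unfolding c_def by (rule directed_SUP(3)[OF alg ne sub bd dir]) (auto simp: D_def)
  have le: "c F \<le> m F" if "F \<in> G" for F
    unfolding c_def using ne that by (intro cSUP_least) (auto simp: D_def)
  have d: "(\<lambda>F. m F - c F) \<in> ba_pos G"
    using ba_diff[OF ba_pos_D(1)[OF m] ca_D[OF ca]] le by (auto simp: ba_pos_def)
  have "k = (\<lambda>_. 0)"
    if k: "k \<in> ca G" "k \<in> ba_pos G" "\<forall>F\<in>G. k F \<le> m F - c F" for k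
  proof -
    have "(\<lambda>F. c F + k F) \<in> D"
      using k ca_add[OF ca k(1)] ba_pos_add[OF S2 k(2)] by (auto simp: D_def algebra_simps)
    from S1[OF this, of \<Omega>] show ?thesis
      using ba_pos_eq_zero[OF alg k(2)] ba_pos_D(2)[OF k(2), of \<Omega>] by simp
  qed
  then have "(\<lambda>F. m F - c F) \<in> pfa G"
    unfolding pfa_iff[OF alg] ba_abs_pos[OF alg d] using ba_pos_D(1)[OF d] by blast
  then show ?thesis using that ca S2 le by blast
qed

theorem Yosida_Hewitt:
  assumes alg: "algebra \<Omega> G" and m: "m \<in> ba G"
  obtains c p where "c \<in> ca G" "p \<in> pfa G" "m = (\<lambda>F. c F + p F)"
proof -
  define a where "a = ba_abs G m"
  define b where "b = (\<lambda>F. a F - m F)"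
  have a: "a \<in> ba_pos G" using ba_abs_D[OF alg m] by (simp add: a_def)
  have b: "b \<in> ba_pos G"
    using ba_diff[OF ba_pos_D(1)[OF a] m] ba_abs_D(2)[OF alg m] by (auto simp: ba_pos_def b_def a_def)
  from Yosida_Hewitt_pos[OF alg a] obtain c where
    c: "c \<in> ca G" "(\<lambda>F. a F - c F) \<in> pfa G" by metis
  from Yosida_Hewitt_pos[OF alg b] obtain d where
    d: "d \<in> ca G" "(\<lambda>F. b F - d F) \<in> pfa G" by metis
  show ?thesis
    by (rule that[OF ca_diff[OF c(1) d(1)] pfa_diff[OF alg c(2) d(2)]]) (auto simp: b_def)
qed

section \<open>Extension to all subsets by compactness\<close>

lemma ba_pos_sum:
  assumes "\<And>i. i \<in> I \<Longrightarrow> m i \<in> ba_pos G"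
  shows "(\<lambda>F. \<Sum>i\<in>I. m i F) \<in> ba_pos G"
  using assms by (induction I rule: infinite_finite_induct) (auto intro: ba_pos_add ba_pos_zero)

lemma ba_pos_trace:
  assumes x: "x \<in> ba_pos (Pow Y)" and S: "X \<inter> S \<subseteq> Y"
  shows "restr (Pow X) (\<lambda>B. x (B \<inter> S)) \<in> ba_pos (Pow X)"
proof (rule ba_pos_I[OF algebra_Pow])
  show "restr (Pow X) (\<lambda>B. x (B \<inter> S)) (E \<union> F) =
      restr (Pow X) (\<lambda>B. x (B \<inter> S)) E + restr (Pow X) (\<lambda>B. x (B \<inter> S)) F"
    if "E \<in> Pow X" "F \<in> Pow X" "E \<inter> F = {}" for E F
  proof -
    have "x ((E \<inter> S) \<union> (F \<inter> S)) = x (E \<inter> S) + x (F \<inter> S)"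
      using that S by (intro ba_Un[OF ba_pos_D(1)[OF x]]) auto
    then show ?thesis using that by (simp add: restr_def Int_Un_distrib2)
  qed
qed (auto simp: restr_def ba_pos_D(2)[OF x])

text \<open>
  In the topology of setwise convergence these set functions form a closed subset of a product of
  compact intervals.
\<close>

lemma compact_ba_pos: "compact {x \<in> ba_pos (Pow X). x X \<le> M}"
proof -
  have cont: "continuous_on UNIV (\<lambda>x :: 'a set \<Rightarrow> real. x B)" for B
    by (rule continuous_on_product_coordinates)
  have "compactin (product_topology (\<lambda>_. euclidean) UNIV) (PiE UNIV (\<lambda>_ :: 'a set. {0..M}))"
    unfolding compactin_PiE by auto
  then have "compact (PiE UNIV (\<lambda>_ :: 'a set. {0..M}))"
    by (simp only: euclidean_product_topology compactin_euclidean_iff)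
  moreover have "closed {x. (\<forall>B. 0 \<le> x B) \<and>
      (\<forall>E F. E \<subseteq> X \<and> F \<subseteq> X \<and> E \<inter> F = {} \<longrightarrow> x (E \<union> F) = x E + x F) \<and>
      (\<forall>B. \<not> B \<subseteq> X \<longrightarrow> x B = (0::real)) \<and> x X \<le> M}" (is "closed ?S")
    by (intro closed_Collect_conj closed_Collect_all closed_Collect_imp open_Collect_const
        closed_Collect_eq closed_Collect_le cont continuous_intros)
  ultimately have "compact (PiE UNIV (\<lambda>_. {0..M}) \<inter> ?S)" by (rule compact_Int_closed)
  moreover have "PiE UNIV (\<lambda>_. {0..M}) \<inter> ?S = {x \<in> ba_pos (Pow X). x X \<le> M}" (is "?L = ?R")
  proof
    show "?L \<subseteq> ?R" by (auto intro!: ba_pos_I[OF algebra_Pow])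
    show "?R \<subseteq> ?L"
    proof
      fix x assume "x \<in> ?R"
      then have x: "x \<in> ba_pos (Pow X)" "x X \<le> M" by auto
      have "x B \<le> M" for B
        using ba_pos_le_space[OF algebra_Pow x(1), of B] x(2) by simp
      then show "x \<in> ?L"
        using x ba_pos_D[OF x(1)] ba_Un[OF ba_pos_D(1)[OF x(1)]]
        by (simp add: PiE_UNIV_domain)
    qed
  qed
  ultimately show ?thesis by simp
qed

lemma ba_pos_finite_intersection:
  assumes closed: "\<And>i. i \<in> I \<Longrightarrow> closed {x. P i x}"
    and fin: "\<And>J. finite J \<Longrightarrow> J \<subseteq> I \<Longrightarrow>
      \<exists>x\<in>ba_pos (Pow X). x X \<le> M \<and> (\<forall>i\<in>J. P i x)"
  shows "\<exists>x\<in>ba_pos (Pow X). x X \<le> M \<and> (\<forall>i\<in>I. P i x)"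
proof -
  have "{x \<in> ba_pos (Pow X). x X \<le> M} \<inter> (\<Inter>i\<in>I. {x. P i x}) \<noteq> {}"
  proof (rule compact_imp_fip_image[OF compact_ba_pos closed])
    fix J assume "finite J" "J \<subseteq> I"
    from fin[OF this] show "{x \<in> ba_pos (Pow X). x X \<le> M} \<inter> (\<Inter>i\<in>J. {x. P i x}) \<noteq> {}"
      by auto
  qed
  then show ?thesis by auto
qed

lemma finite_partition_refining:
  assumes "algebra \<Omega> G" "finite H" "H \<subseteq> G"
  shows "\<exists>P. finite P \<and> P \<subseteq> G \<and> disjoint P \<and> \<Union>P = \<Omega> \<and> (\<forall>T\<in>P. \<forall>h\<in>H. T \<subseteq> h \<or> T \<inter> h = {})"
  using assms(2,3)
proof (induction H)
  case empty
  interpret algebra \<Omega> G by fact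
  show ?case by (intro exI[of _ "{\<Omega>}"]) (auto simp: disjoint_def)
next
  case (insert h H)
  interpret algebra \<Omega> G by fact
  obtain P where P: "finite P" "P \<subseteq> G" "disjoint P" "\<Union>P = \<Omega>"
    "\<forall>T\<in>P. \<forall>h\<in>H. T \<subseteq> h \<or> T \<inter> h = {}"
    using insert by auto
  let ?P = "(\<lambda>T. T \<inter> h) ` P \<union> (\<lambda>T. T - h) ` P"
  have "disjoint ?P"
    using P(3) unfolding disjoint_def by blast
  moreover have "\<Union>?P = \<Omega>" using P(4) by auto
  moreover have "?P \<subseteq> G" using P(2) insert.prems by auto
  moreover have "\<forall>T\<in>?P. \<forall>h'\<in>insert h H. T \<subseteq> h' \<or> T \<inter> h' = {}" using P(5) by blast
  ultimately show ?case using P(1) by (intro exI[of _ ?P]) auto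
qed

text \<open>
  Along a finite partition of \<open>\<Omega>\<close> one may spread the mass of each cell \<open>F\<close> over the cell in some
  prescribed way \<open>\<kappa> F\<close>, which is right for all unions of cells. Any finitely many
  sets lie in the algebra of such a partition, and compactness does the rest. The map
  \<open>\<phi>\<close> serves to prescribe masses on cylinders only; the closed set \<open>N\<close> carries further
  properties of the spread masses to the limit.
\<close>

lemma extension_by_spreading:
  fixes \<phi> :: "'b \<Rightarrow> 'a"
  assumes alg: "algebra \<Omega> G" and \<phi>: "\<phi> ` X \<subseteq> \<Omega>" and \<mu>: "\<mu> \<in> ba_pos G"
    and \<kappa>: "\<And>F. F \<in> G \<Longrightarrow> \<kappa> F \<in> ba_pos (Pow X)"
      "\<And>F. F \<in> G \<Longrightarrow> \<kappa> F (X \<inter> \<phi> -` F) = \<mu> F" "\<And>F. F \<in> G \<Longrightarrow> \<kappa> F X = \<mu> F"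
    and N: "closed N"
      "\<And>P. finite P \<Longrightarrow> P \<subseteq> G \<Longrightarrow> disjoint P \<Longrightarrow> (\<lambda>B. \<Sum>F\<in>P. \<kappa> F B) \<in> N"
  shows "\<exists>x\<in>ba_pos (Pow X). x \<in> N \<and> (\<forall>F\<in>G. x (X \<inter> \<phi> -` F) = \<mu> F)"
proof -
  interpret algebra \<Omega> G by fact
  have "\<exists>x\<in>ba_pos (Pow X). x X \<le> \<mu> \<Omega> \<and> (\<forall>F\<in>G. x (X \<inter> \<phi> -` F) = \<mu> F \<and> x \<in> N)"
  proof (rule ba_pos_finite_intersection)
    show "closed {x. x (X \<inter> \<phi> -` F) = \<mu> F \<and> x \<in> N}" for F
      using N(1) by (intro closed_Collect_conj closed_Collect_eq continuous_intros
          continuous_on_product_coordinates) simp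
    fix H assume H: "finite H" "H \<subseteq> G"
    obtain P where P: "finite P" "P \<subseteq> G" "disjoint P" "\<Union>P = \<Omega>"
      "\<forall>T\<in>P. \<forall>h\<in>H. T \<subseteq> h \<or> T \<inter> h = {}"
      using finite_partition_refining[OF alg H] by auto
    define x where "x = (\<lambda>B. \<Sum>F\<in>P. \<kappa> F B)"
    have pos: "x \<in> ba_pos (Pow X)"
      unfolding x_def using \<kappa>(1) P(2) by (intro ba_pos_sum) auto
    have part: "(\<Sum>T\<in>P. \<mu> (T \<inter> h)) = \<mu> h" if "h \<in> G" for h
    proof -
      have "(\<Sum>T\<in>P. \<mu> (T \<inter> h)) = \<mu> (\<Union>T\<in>P. T \<inter> h)"
        using P that by (intro ba_sum[OF alg ba_pos_D(1)[OF \<mu>]])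
          (auto simp: disjoint_family_on_def disjoint_def)
      moreover have "(\<Union>T\<in>P. T \<inter> h) = h" using P(4) sets_into_space[OF that] by auto
      ultimately show ?thesis by simp
    qed
    have "x X = (\<Sum>T\<in>P. \<mu> (T \<inter> \<Omega>))"
      unfolding x_def using P(2) \<kappa>(3) sets_into_space
      by (intro sum.cong) (auto simp: Int_absorb2)
    then have "x X = \<mu> \<Omega>" using part by simp
    moreover have "x (X \<inter> \<phi> -` h) = \<mu> h" if "h \<in> H" for h
    proof -
      have "\<kappa> T (X \<inter> \<phi> -` h) = \<mu> (T \<inter> h)" if T: "T \<in> P" for T
      proof (cases "T \<subseteq> h")
        case True
        have TG: "T \<in> G" using T P(2) by auto
        have "\<kappa> T (X \<inter> \<phi> -` T) \<le> \<kappa> T (X \<inter> \<phi> -` h)" "\<kappa> T (X \<inter> \<phi> -` h) \<le> \<kappa> T X"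
          using True by (intro ba_pos_mono[OF algebra_Pow \<kappa>(1)[OF TG]]; auto)+
        then show ?thesis using \<kappa>(2,3)[OF TG] True by (simp add: Int_absorb2)
      next
        case False
        have TG: "T \<in> G" using T P(2) by auto
        have dis: "T \<inter> h = {}" using P(5) T \<open>h \<in> H\<close> False by auto
        have "\<kappa> T ((X \<inter> \<phi> -` T) \<union> (X \<inter> \<phi> -` h)) = \<kappa> T (X \<inter> \<phi> -` T) + \<kappa> T (X \<inter> \<phi> -` h)"
          using dis by (intro ba_Un[OF ba_pos_D(1)[OF \<kappa>(1)[OF TG]]]) auto
        moreover have "\<kappa> T ((X \<inter> \<phi> -` T) \<union> (X \<inter> \<phi> -` h)) \<le> \<kappa> T X"
          by (rule ba_pos_le_space[OF algebra_Pow \<kappa>(1)[OF TG]])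
        ultimately have "\<kappa> T (X \<inter> \<phi> -` h) \<le> 0" using \<kappa>(2,3)[OF TG] by simp
        then show ?thesis
          using ba_pos_D(2)[OF \<kappa>(1)[OF TG], of "X \<inter> \<phi> -` h"] dis
            ba_empty[OF alg ba_pos_D(1)[OF \<mu>]] by simp
      qed
      then show ?thesis using part[of h] H(2) that by (auto simp: x_def)
    qed
    moreover have "x \<in> N" unfolding x_def by (rule N(2)[OF P(1-3)])
    ultimately show "\<exists>x\<in>ba_pos (Pow X). x X \<le> \<mu> \<Omega> \<and> (\<forall>F\<in>H. x (X \<inter> \<phi> -` F) = \<mu> F \<and> x \<in> N)"
      using pos by (intro bexI[of _ x]) auto
  qed
  then show ?thesis by auto
qed

text \<open>
  Without a dominating set function the mass of each cell is put on a single point over the cell.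
\<close>

lemma extension_exists:
  fixes \<phi> :: "'b \<Rightarrow> 'a"
  assumes alg: "algebra \<Omega> G" and \<phi>: "\<phi> ` X = \<Omega>" and \<mu>: "\<mu> \<in> ba_pos G"
  shows "\<exists>x\<in>ba_pos (Pow X). \<forall>F\<in>G. x (X \<inter> \<phi> -` F) = \<mu> F"
proof -
  interpret algebra \<Omega> G by fact
  define \<kappa> where "\<kappa> F = (\<lambda>B. if B \<subseteq> X \<and> (SOME b. b \<in> X \<inter> \<phi> -` F) \<in> B then \<mu> F else 0)" for F
  have pick: "(SOME b. b \<in> X \<inter> \<phi> -` F) \<in> X \<inter> \<phi> -` F" if F: "F \<in> G" "F \<noteq> {}" for F
  proof -
    obtain a where "a \<in> F" using F(2) by auto
    moreover from this have "a \<in> \<phi> ` X" using sets_into_space[OF F(1)] \<phi> by auto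
    ultimately have "X \<inter> \<phi> -` F \<noteq> {}" by auto
    then show ?thesis unfolding some_in_eq .
  qed
  have "\<kappa> F \<in> ba_pos (Pow X)" for F
    by (rule ba_pos_I[OF algebra_Pow]) (auto simp: \<kappa>_def ba_pos_D(2)[OF \<mu>])
  moreover have "\<kappa> F (X \<inter> \<phi> -` F) = \<mu> F" "\<kappa> F X = \<mu> F" if "F \<in> G" for F
    using pick[OF that] ba_empty[OF alg ba_pos_D(1)[OF \<mu>]] by (auto simp: \<kappa>_def)
  ultimately show ?thesis
    using extension_by_spreading[OF alg _ \<mu>, of \<phi> X \<kappa> UNIV] \<phi> by auto
qed

text \<open>
  Below a given \<open>\<nu>\<close> the mass of each cell is spread proportionally to \<open>\<nu>\<close>.
\<close>

lemma dominated_extension_exists: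
  fixes \<phi> :: "'b \<Rightarrow> 'a"
  assumes alg: "algebra \<Omega> G" and \<phi>: "\<phi> ` X \<subseteq> \<Omega>" and \<mu>: "\<mu> \<in> ba_pos G"
    and \<nu>: "\<nu> \<in> ba_pos (Pow X)" and le: "\<And>F. F \<in> G \<Longrightarrow> \<mu> F \<le> \<nu> (X \<inter> \<phi> -` F)"
  shows "\<exists>x\<in>ba_pos (Pow X). (\<forall>B. x B \<le> \<nu> B) \<and> (\<forall>F\<in>G. x (X \<inter> \<phi> -` F) = \<mu> F)"
proof -
  interpret algebra \<Omega> G by fact
  \<comment> \<open>If the denominator is \<open>0\<close>, then so is \<open>\<mu> F\<close>, and \<open>r F = 0\<close> is the right value.\<close>
  define r where "r F = \<mu> F / \<nu> (X \<inter> \<phi> -` F)" for F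
  define \<kappa> where "\<kappa> F = (\<lambda>B. r F * restr (Pow X) (\<lambda>B. \<nu> (B \<inter> \<phi> -` F)) B)" for F
  have r: "0 \<le> r F" for F using ba_pos_D(2)[OF \<mu>] ba_pos_D(2)[OF \<nu>] by (simp add: r_def)
  have r1: "r F \<le> 1" if "F \<in> G" for F
    using le[OF that] ba_pos_D(2)[OF \<nu>, of "X \<inter> \<phi> -` F"] ba_pos_D(2)[OF \<mu>, of F]
    by (auto simp: r_def divide_le_eq_1 less_le)
  have tr: "restr (Pow X) (\<lambda>B. \<nu> (B \<inter> \<phi> -` F)) \<in> ba_pos (Pow X)" for F
    by (rule ba_pos_trace[OF \<nu>]) auto
  have \<kappa>: "\<kappa> F \<in> ba_pos (Pow X)" for F
    using ba_Un[OF ba_pos_D(1)[OF tr[of F]]] ba_pos_D(2,3)[OF tr[of F]] r[of F]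
    by (intro ba_pos_I[OF algebra_Pow]) (auto simp: \<kappa>_def distrib_left)
  have "\<kappa> F X = \<mu> F" if "F \<in> G" for F
    using le[OF that] ba_pos_D(2)[OF \<mu>, of F] by (auto simp: \<kappa>_def r_def restr_def)
  moreover have "\<kappa> F (X \<inter> \<phi> -` F) = \<kappa> F X" for F
    by (simp add: \<kappa>_def restr_def Int_assoc)
  moreover have "(\<Sum>F\<in>P. \<kappa> F B) \<le> \<nu> B"
    if P: "finite P" "P \<subseteq> G" "disjoint P" for P B
  proof (cases "B \<subseteq> X")
    case True
    have "(\<Sum>F\<in>P. \<kappa> F B) \<le> (\<Sum>F\<in>P. \<nu> (B \<inter> \<phi> -` F))"
      using True r1 P(2) ba_pos_D(2)[OF \<nu>]
      by (intro sum_mono) (auto simp: \<kappa>_def restr_def intro!: mult_left_le_one_le r)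
    also have "\<dots> = \<nu> (\<Union>F\<in>P. B \<inter> \<phi> -` F)"
      using P True by (intro ba_sum[OF algebra_Pow ba_pos_D(1)[OF \<nu>]])
        (auto simp: disjoint_family_on_def disjoint_def)
    also have "\<dots> \<le> \<nu> B"
      using True by (intro ba_pos_mono[OF algebra_Pow \<nu>]) auto
    finally show ?thesis .
  qed (simp add: \<kappa>_def restr_def ba_pos_D(2)[OF \<nu>])
  moreover have "closed {x. \<forall>B. x B \<le> \<nu> B}"
    by (intro closed_Collect_all closed_Collect_le continuous_on_product_coordinates
        continuous_intros)
  ultimately show ?thesis
    using extension_by_spreading[OF alg \<phi> \<mu>, of \<kappa> "{x. \<forall>B. x B \<le> \<nu> B}"] \<kappa> by auto
qed

section \<open>Set functions on the product with the half line\<close>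

text \<open>
  A condition \<open>C t u\<close> concerns the strip \<open>\<Omega> \<times> {t<..u}\<close> only. If it can be met on every strip and
  passes from two adjacent strips to their union, then for finitely many times it is met by gluing
  solutions on the successive strips, and for all times by compactness. The limit may have mass at
  infinity; the supremum of its traces on the sets \<open>\<Omega> \<times> {0<..u}\<close> has none and is unchanged on the
  strips.
\<close>

lemma strip_gluing:
  fixes C :: "real \<Rightarrow> real \<Rightarrow> (('a \<times> real) set \<Rightarrow> real) \<Rightarrow> bool"
  assumes cell: "\<And>t u. 0 \<le> t \<Longrightarrow> t < u \<Longrightarrow> \<exists>x\<in>ba_pos (Pow (Omega_bar \<Omega>)). C t u x"
    and local: "\<And>t u x y. 0 \<le> t \<Longrightarrow> t < u \<Longrightarrow> C t u x \<Longrightarrow>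
      (\<And>B. B \<subseteq> \<Omega> \<times> {t<..u} \<Longrightarrow> y B = x B) \<Longrightarrow> C t u y"
    and glue: "\<And>t u v x. 0 \<le> t \<Longrightarrow> t < u \<Longrightarrow> u < v \<Longrightarrow> x \<in> ba_pos (Pow (Omega_bar \<Omega>)) \<Longrightarrow>
      C t u x \<Longrightarrow> C u v x \<Longrightarrow> C t v x"
    and closed: "\<And>t u. closed {x. C t u x}"
    and bound: "\<And>u x. 0 < u \<Longrightarrow> x \<in> ba_pos (Pow (Omega_bar \<Omega>)) \<Longrightarrow> C 0 u x \<Longrightarrow>
      x (\<Omega> \<times> {0<..u}) \<le> M"
  shows "\<exists>x\<in>frakM \<Omega>. x (\<Omega> \<times> {0}) = 0 \<and> (\<forall>t u. 0 \<le> t \<longrightarrow> t < u \<longrightarrow> C t u x)"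
proof -
  let ?X = "Omega_bar \<Omega>"
  have fin: "\<exists>x\<in>ba_pos (Pow ?X). \<forall>t\<in>T. \<forall>u\<in>T. t < u \<longrightarrow> C t u x"
    if "finite T" "T \<subseteq> {0..}" for T
    using that
  proof (induction T rule: finite_linorder_min_induct)
    case empty
    then show ?case using ba_pos_zero by auto
  next
    case (insert b T)
    then obtain x where x: "x \<in> ba_pos (Pow ?X)" "\<forall>t\<in>T. \<forall>u\<in>T. t < u \<longrightarrow> C t u x" by auto
    show ?case
    proof (cases "T = {}")
      case True
      then show ?thesis using x by auto
    next
      case False
      define a where "a = Min T"
      have a: "a \<in> T" "\<And>t. t \<in> T \<Longrightarrow> a \<le> t" using False insert.hyps by (auto simp: a_def)
      have ba: "0 \<le> b" "b < a" using a insert by auto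
      obtain y where y: "y \<in> ba_pos (Pow ?X)" "C b a y" using cell[OF ba] by auto
      define z where "z B = restr (Pow ?X) (\<lambda>B. y (B \<inter> \<Omega> \<times> {b<..a})) B +
        restr (Pow ?X) (\<lambda>B. x (B \<inter> \<Omega> \<times> {a<..})) B" for B
      have z: "z \<in> ba_pos (Pow ?X)"
        unfolding z_def using x(1) y(1) by (intro ba_pos_add ba_pos_trace) auto
      have empty: "x {} = 0" "y {} = 0"
        using x(1) y(1) by (auto intro!: ba_empty[OF algebra_Pow] dest: ba_pos_D(1))
      have zy: "z B = y B" if "B \<subseteq> \<Omega> \<times> {b<..a}" for B
      proof -
        have "B \<subseteq> ?X" using that ba by (force simp: Omega_bar_def)
        moreover have "B \<inter> \<Omega> \<times> {b<..a} = B" "B \<inter> \<Omega> \<times> {a<..} = {}" using that by auto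
        ultimately show ?thesis by (simp add: z_def restr_def empty)
      qed
      have zx: "z B = x B" if "B \<subseteq> \<Omega> \<times> {t<..u}" "a \<le> t" for B t u
      proof -
        have "B \<subseteq> ?X" using that ba by (force simp: Omega_bar_def)
        moreover have "B \<inter> \<Omega> \<times> {b<..a} = {}" "B \<inter> \<Omega> \<times> {a<..} = B" using that by auto
        ultimately show ?thesis by (simp add: z_def restr_def empty)
      qed
      have T: "C t u z" if "t \<in> T" "u \<in> T" "t < u" for t u
        using that insert.prems x(2) zx a(2) by (intro local[of t u x z]) auto
      have ab: "C b a z" by (rule local[OF ba y(2) zy])
      have "C b u z" if "u \<in> T" for u
      proof (cases "u = a")
        case False
        then have "a < u" using a(2)[OF that] by simp
        then show ?thesis using glue[OF ba _ z ab T[OF a(1) that]] by blast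
      qed (use ab in simp)
      then show ?thesis using T z insert.hyps by (intro bexI[of _ z]) (auto dest: order.asym)
    qed
  qed
  have fin_bound: "\<exists>x\<in>ba_pos (Pow ?X). x ?X \<le> M \<and> (\<forall>i\<in>J. case i of (t, u) \<Rightarrow> C t u x)"
    if J: "finite J" "J \<subseteq> {(t, u). 0 \<le> t \<and> t < u}" for J
  proof -
    \<comment> \<open>With \<open>0\<close> among the times, the condition on the strip from \<open>0\<close> to the last time \<open>v\<close> bounds
      the mass; having \<open>1\<close> among them ensures \<open>0 < v\<close>.\<close>
    define T where "T = insert 0 (insert 1 (fst ` J \<union> snd ` J))"
    have T: "finite T" "T \<subseteq> {0..}" using J by (auto simp: T_def)
    obtain x where x: "x \<in> ba_pos (Pow ?X)" "\<And>t u. t \<in> T \<Longrightarrow> u \<in> T \<Longrightarrow> t < u \<Longrightarrow> C t u x"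
      using fin[OF T] by blast
    define v where "v = Max T"
    have "T \<noteq> {}" by (simp add: T_def)
    then have v: "v \<in> T" "\<And>t. t \<in> T \<Longrightarrow> t \<le> v" using T(1) by (auto simp: v_def)
    have v0: "0 < v" using v(2)[of 1] by (simp add: T_def)
    define y where "y = restr (Pow ?X) (\<lambda>B. x (B \<inter> \<Omega> \<times> {0<..v}))"
    have y: "y \<in> ba_pos (Pow ?X)"
      unfolding y_def by (rule ba_pos_trace[OF x(1)]) auto
    have "?X \<inter> \<Omega> \<times> {0<..v} = \<Omega> \<times> {0<..v}" by (auto simp: Omega_bar_def)
    then have "y ?X \<le> M"
      using bound[OF v0 x(1)] x(2)[OF _ v(1) v0] by (simp add: y_def restr_def T_def)
    moreover have "C t u y" if "(t, u) \<in> J" for t u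
    proof (rule local)
      have tu: "t \<in> T" "u \<in> T" "t < u" "0 \<le> t" using that J by (force simp: T_def)+
      then show "0 \<le> t" "t < u" "C t u x" using x(2) by auto
      fix B assume B: "B \<subseteq> \<Omega> \<times> {t<..u}"
      then have "B \<subseteq> ?X" "B \<subseteq> \<Omega> \<times> {0<..v}" using tu v(2)[OF tu(2)] by (force simp: Omega_bar_def)+
      then show "y B = x B" by (simp add: y_def restr_def Int_absorb2)
    qed
    ultimately show ?thesis using y by auto
  qed
  have "\<exists>x\<in>ba_pos (Pow ?X). x ?X \<le> M \<and> (\<forall>i\<in>{(t, u). 0 \<le> t \<and> t < u}. case i of (t, u) \<Rightarrow> C t u x)"
  proof (rule ba_pos_finite_intersection[OF _ fin_bound])
    show "closed {x. case i of (t, u) \<Rightarrow> C t u x}" for i by (cases i) (simp add: closed)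
  qed
  then obtain x where x: "x \<in> ba_pos (Pow ?X)" "\<And>t u. 0 \<le> t \<Longrightarrow> t < u \<Longrightarrow> C t u x" by auto
  define tr where "tr u = restr (Pow ?X) (\<lambda>B. x (B \<inter> \<Omega> \<times> {0<..u}))" for u :: real
  define D where "D = range tr"
  define s where "s = (\<lambda>B. SUP l\<in>D. l B)"
  have tr: "tr u \<in> ba_pos (Pow ?X)" for u
    unfolding tr_def by (rule ba_pos_trace[OF x(1)]) auto
  have tr_le: "tr u B \<le> x B" for u B
  proof (cases "B \<subseteq> ?X")
    case True
    then have "x (B \<inter> \<Omega> \<times> {0<..u}) \<le> x B"
      by (intro ba_pos_mono[OF algebra_Pow x(1)]) auto
    then show ?thesis using True by (simp add: tr_def restr_def)
  qed (simp add: tr_def restr_def ba_pos_D(2)[OF x(1)])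
  have tr_mono: "tr u B \<le> tr v B" if "u \<le> v" for u v B
  proof (cases "B \<subseteq> ?X")
    case True
    then have "x (B \<inter> \<Omega> \<times> {0<..u}) \<le> x (B \<inter> \<Omega> \<times> {0<..v})"
      using that by (intro ba_pos_mono[OF algebra_Pow x(1)]) auto
    then show ?thesis using True by (simp add: tr_def restr_def)
  qed (simp add: tr_def restr_def)
  have ne: "D \<noteq> {}" and sub: "D \<subseteq> ba_pos (Pow ?X)" and bd: "\<forall>l\<in>D. l ?X \<le> x ?X"
    using tr tr_le by (auto simp: D_def)
  have dir: "\<forall>k\<in>D. \<forall>l\<in>D. \<exists>n\<in>D. \<forall>F\<in>Pow ?X. k F \<le> n F \<and> l F \<le> n F"
  proof (intro ballI)
    fix k l assume "k \<in> D" "l \<in> D"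
    then obtain u v where "k = tr u" "l = tr v" by (auto simp: D_def)
    then show "\<exists>n\<in>D. \<forall>F\<in>Pow ?X. k F \<le> n F \<and> l F \<le> n F"
      using tr_mono[of u "max u v"] tr_mono[of v "max u v"]
      by (intro bexI[of _ "tr (max u v)"]) (auto simp: D_def)
  qed
  have s_ge: "tr u B \<le> s B" for u B
    unfolding s_def using directed_SUP(1)[OF algebra_Pow ne sub bd dir] by (auto simp: D_def)
  have s: "s \<in> ba_pos (Pow ?X)"
    unfolding s_def by (rule directed_SUP(2)[OF algebra_Pow ne sub bd dir])
  have s_le: "s B \<le> c" if "\<And>u. tr u B \<le> c" for B c
    unfolding s_def using ne that by (intro cSUP_least) (auto simp: D_def)
  have "C t u s" if "0 \<le> t" "t < u" for t u
  proof (rule local[OF that x(2)[OF that]])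
    fix B assume B: "B \<subseteq> \<Omega> \<times> {t<..u}"
    then have "B \<subseteq> ?X" "B \<subseteq> \<Omega> \<times> {0<..u}" using that by (force simp: Omega_bar_def)+
    then have "tr u B = x B" by (simp add: tr_def restr_def Int_absorb2)
    then show "s B = x B" using s_ge[of u B] s_le[of B "x B"] tr_le by (simp add: antisym)
  qed
  moreover have "s (\<Omega> \<times> {0}) = 0"
  proof (rule antisym[OF s_le ba_pos_D(2)[OF s]])
    have "\<Omega> \<times> {0} \<inter> \<Omega> \<times> {0<..u} = {}" for u :: real by auto
    then show "tr u (\<Omega> \<times> {0}) \<le> 0" for u
      using ba_empty[OF algebra_Pow ba_pos_D(1)[OF x(1)]] by (simp add: tr_def restr_def)
  qed
  moreover have "((\<lambda>t. s (\<Omega> \<times> {t<..})) \<longlongrightarrow> 0) at_top"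
  proof (rule order_tendstoI)
    show "\<forall>\<^sub>F t in at_top. c < s (\<Omega> \<times> {t<..})" if "c < 0" for c
      using less_le_trans[OF that ba_pos_D(2)[OF s]] by simp
    fix e :: real assume e: "0 < e"
    have "\<exists>u. s ?X - e < tr u ?X"
      using s_le[of ?X "s ?X - e"] e by (force simp: not_less[symmetric])
    then obtain u where u: "s ?X - e < tr u ?X" by auto
    have "s (\<Omega> \<times> {t<..}) < e" if t: "max u 0 \<le> t" for t
    proof -
      have "tr u ?X = tr u (\<Omega> \<times> {0<..u})"
        by (simp add: tr_def restr_def Omega_bar_def) (auto intro!: arg_cong[where f=x])
      also have "\<dots> \<le> s (\<Omega> \<times> {0<..u})" by (rule s_ge)
      finally have "tr u ?X \<le> s (\<Omega> \<times> {0<..u})" .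
      moreover have "s (\<Omega> \<times> {0<..u} \<union> \<Omega> \<times> {t<..}) = s (\<Omega> \<times> {0<..u}) + s (\<Omega> \<times> {t<..})"
        using t by (intro ba_Un[OF ba_pos_D(1)[OF s]]) (auto simp: Omega_bar_def)
      moreover have "s (\<Omega> \<times> {0<..u} \<union> \<Omega> \<times> {t<..}) \<le> s ?X"
        by (rule ba_pos_le_space[OF algebra_Pow s])
      ultimately show ?thesis using u by simp
    qed
    then show "\<forall>\<^sub>F t in at_top. s (\<Omega> \<times> {t<..}) < e"
      unfolding eventually_at_top_linorder by blast
  qed
  ultimately show ?thesis using s by (auto simp: frakM_def)
qed

lemma rectangle_in: "F \<subseteq> \<Omega> \<Longrightarrow> I \<subseteq> {0..} \<Longrightarrow> F \<times> I \<in> Pow (Omega_bar \<Omega>)"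
  by (auto simp: Omega_bar_def)

lemma rectangle_split:
  assumes "x \<in> ba (Pow (Omega_bar \<Omega>))" "F \<subseteq> \<Omega>" "0 \<le> t" "t \<le> u"
  shows "x (F \<times> {t<..}) = x (F \<times> {t<..u}) + x (F \<times> {u<..})"
    and "u \<le> v \<Longrightarrow> x (F \<times> {t<..v}) = x (F \<times> {t<..u}) + x (F \<times> {u<..v})"
proof -
  have add: "x (F \<times> (I \<union> J)) = x (F \<times> I) + x (F \<times> J)"
    if "I \<subseteq> {0..}" "J \<subseteq> {0..}" "I \<inter> J = {}" for I J
  proof -
    have "F \<times> I \<inter> F \<times> J = {}" using that(3) by auto
    then show ?thesis
      using ba_Un[OF assms(1) rectangle_in[OF assms(2) that(1)] rectangle_in[OF assms(2) that(2)]]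
      by (simp add: Sigma_Un_distrib2)
  qed
  have I: "{t<..u} \<subseteq> {0..}" "{u<..} \<subseteq> {0..}" "{u<..v} \<subseteq> {0..}" using assms(3,4) by auto
  have "{t<..} = {t<..u} \<union> {u<..}" "{t<..u} \<inter> {u<..} = {}" using assms(4) by auto
  then show "x (F \<times> {t<..}) = x (F \<times> {t<..u}) + x (F \<times> {u<..})"
    using add[OF I(1,2)] by simp
  assume "u \<le> v"
  then have "{t<..v} = {t<..u} \<union> {u<..v}" "{t<..u} \<inter> {u<..v} = {}" using assms(4) by auto
  then show "x (F \<times> {t<..v}) = x (F \<times> {t<..u}) + x (F \<times> {u<..v})"
    using add[OF I(1,3)] by simp
qed

lemma rectangle_Un:
  assumes "x \<in> ba (Pow (Omega_bar \<Omega>))" "E \<subseteq> \<Omega>" "F \<subseteq> \<Omega>" "E \<inter> F = {}" "I \<subseteq> {0..}"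
  shows "x ((E \<union> F) \<times> I) = x (E \<times> I) + x (F \<times> I)"
proof -
  have "E \<times> I \<inter> F \<times> I = {}" using assms(4) by auto
  then show ?thesis
    using ba_Un[OF assms(1) rectangle_in rectangle_in, of E I F I] assms
    by (simp add: Sigma_Un_distrib1)
qed

lemma rectangle_mono:
  assumes "x \<in> ba_pos (Pow (Omega_bar \<Omega>))" "E \<subseteq> F" "F \<subseteq> \<Omega>" "I \<subseteq> J" "J \<subseteq> {0..}"
  shows "x (E \<times> I) \<le> x (F \<times> J)"
  using assms rectangle_in[of E \<Omega> I] rectangle_in[of F \<Omega> J]
  by (intro ba_pos_mono[OF algebra_Pow assms(1)]) auto

lemma frakM_D:
  assumes "x \<in> frakM \<Omega>"
  shows "x \<in> ba_pos (Pow (Omega_bar \<Omega>))" "x \<in> ba (Pow (Omega_bar \<Omega>))"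
  using assms by (auto simp: frakM_def ba_pos_def)

lemma frakM_tendsto:
  assumes x: "x \<in> frakM \<Omega>" and F: "F \<subseteq> \<Omega>"
  shows "((\<lambda>u. x (F \<times> {u<..})) \<longlongrightarrow> 0) at_top"
    and "0 \<le> t \<Longrightarrow> ((\<lambda>u. x (F \<times> {t<..u})) \<longlongrightarrow> x (F \<times> {t<..})) at_top"
proof -
  note M = frakM_D[OF x]
  show l: "((\<lambda>u. x (F \<times> {u<..})) \<longlongrightarrow> 0) at_top"
  proof (rule tendsto_sandwich[of "\<lambda>_. 0"])
    show "((\<lambda>u. x (\<Omega> \<times> {u<..})) \<longlongrightarrow> 0) at_top" using x by (simp add: frakM_def)
    show "\<forall>\<^sub>F u in at_top. x (F \<times> {u<..}) \<le> x (\<Omega> \<times> {u<..})"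
      using F by (auto intro!: rectangle_mono[OF M(1)] eventually_at_top_linorderI[of 0])
  qed (auto simp: ba_pos_D(2)[OF M(1)])
  assume t: "0 \<le> t"
  have "((\<lambda>u. x (F \<times> {t<..}) - x (F \<times> {u<..})) \<longlongrightarrow> x (F \<times> {t<..}) - 0) at_top"
    by (intro tendsto_intros l)
  moreover have "\<forall>\<^sub>F u in at_top. x (F \<times> {t<..}) - x (F \<times> {u<..}) = x (F \<times> {t<..u})"
    using rectangle_split(1)[OF M(2) F t] by (auto intro!: eventually_at_top_linorderI[of t])
  ultimately show "((\<lambda>u. x (F \<times> {t<..u})) \<longlongrightarrow> x (F \<times> {t<..})) at_top"
    by (simp add: tendsto_cong)
qed

text \<open>
  The part of \<open>x\<close> outside the strip \<open>\<Omega> \<times> {0<..u}\<close> has mass at most \<open>x (\<Omega> \<times> {u<..})\<close>, which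
  tends to \<open>0\<close>.
\<close>

lemma frakM_le_if_le_on_strips:
  assumes x: "x \<in> frakM \<Omega>" "x (\<Omega> \<times> {0}) = 0" and z: "z \<in> ba_pos (Pow (Omega_bar \<Omega>))"
    and le: "\<And>u B. 0 < u \<Longrightarrow> B \<subseteq> \<Omega> \<times> {0<..u} \<Longrightarrow> x B \<le> z B"
  shows "x B \<le> z B"
proof (cases "B \<subseteq> Omega_bar \<Omega>")
  case B: True
  note M = frakM_D[OF x(1)]
  have "x B \<le> z B + x (\<Omega> \<times> {u<..})" if u: "0 < u" for u
  proof -
    have sub: "\<Omega> \<times> {0} \<subseteq> Omega_bar \<Omega>" "\<Omega> \<times> {u<..} \<subseteq> Omega_bar \<Omega>"
      using u by (auto simp: Omega_bar_def)
    have "x B = x (B \<inter> \<Omega> \<times> {0}) + x (B - \<Omega> \<times> {0})"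
      using B sub by (intro ba_split[OF algebra_Pow M(2)]) auto
    moreover have "x (B - \<Omega> \<times> {0}) =
        x ((B - \<Omega> \<times> {0}) \<inter> \<Omega> \<times> {u<..}) + x ((B - \<Omega> \<times> {0}) - \<Omega> \<times> {u<..})"
      using B sub by (intro ba_split[OF algebra_Pow M(2)]) auto
    moreover have "x (B \<inter> \<Omega> \<times> {0}) \<le> x (\<Omega> \<times> {0})"
      using sub by (intro ba_pos_mono[OF algebra_Pow M(1)]) auto
    moreover have "x ((B - \<Omega> \<times> {0}) \<inter> \<Omega> \<times> {u<..}) \<le> x (\<Omega> \<times> {u<..})"
      using sub by (intro ba_pos_mono[OF algebra_Pow M(1)]) auto
    moreover have "(B - \<Omega> \<times> {0}) - \<Omega> \<times> {u<..} \<subseteq> \<Omega> \<times> {0<..u}"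
      using B by (force simp: Omega_bar_def)
    then have "x ((B - \<Omega> \<times> {0}) - \<Omega> \<times> {u<..}) \<le> z ((B - \<Omega> \<times> {0}) - \<Omega> \<times> {u<..})"
      using le[OF u] by blast
    moreover have "z ((B - \<Omega> \<times> {0}) - \<Omega> \<times> {u<..}) \<le> z B"
      using B by (intro ba_pos_mono[OF algebra_Pow z]) auto
    ultimately show ?thesis using x(2) by linarith
  qed
  moreover have "((\<lambda>u. z B + x (\<Omega> \<times> {u<..})) \<longlongrightarrow> z B + 0) at_top"
    by (intro tendsto_intros frakM_tendsto(1)[OF x(1)]) simp
  ultimately show ?thesis
    by (intro tendsto_lowerbound[of "\<lambda>u. z B + x (\<Omega> \<times> {u<..})" "z B" at_top])
      (auto intro!: eventually_at_top_linorderI[of 1])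
next
  case False
  then show ?thesis using ba_pos_D(3)[OF frakM_D(1)[OF x(1)]] ba_pos_D(2)[OF z] by simp
qed

locale algebra_filtration =
  fixes \<Omega> :: "'a set" and A :: "real \<Rightarrow> 'a set set"
  assumes alg: "0 \<le> t \<Longrightarrow> algebra \<Omega> (A t)"
    and mono: "0 \<le> t \<Longrightarrow> t \<le> u \<Longrightarrow> A t \<subseteq> A u"
begin

lemma A_subset: "0 \<le> t \<Longrightarrow> F \<in> A t \<Longrightarrow> F \<subseteq> \<Omega>"
  using algebra.axioms(1)[OF alg] ring_of_sets.axioms(1) semiring_of_sets.axioms(1)
    subset_class.sets_into_space by blast

lemma space_in_A: "0 \<le> t \<Longrightarrow> \<Omega> \<in> A t"
  using algebra.top[OF alg] .

lemma algebra_union_alg: "algebra \<Omega> (union_alg A)"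
  unfolding algebra_iff_Un
proof (intro conjI ballI)
  show "union_alg A \<subseteq> Pow \<Omega>" using A_subset by (auto simp: union_alg_def)
  show "{} \<in> union_alg A"
    using alg[of 0] by (auto simp: union_alg_def algebra_iff_Un)
  fix E assume "E \<in> union_alg A"
  then obtain t where t: "0 \<le> t" "E \<in> A t" by (auto simp: union_alg_def)
  show "\<Omega> - E \<in> union_alg A"
    using alg[OF t(1)] t by (auto simp: union_alg_def algebra_iff_Un)
  fix F assume "F \<in> union_alg A"
  then obtain u where u: "0 \<le> u" "F \<in> A u" by (auto simp: union_alg_def)
  have "E \<in> A (max t u)" "F \<in> A (max t u)"
    using mono[of t "max t u"] mono[of u "max t u"] t u by auto
  moreover have "0 \<le> max t u" using t by simp
  ultimately show "E \<union> F \<in> union_alg A"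
    using alg[of "max t u"] unfolding union_alg_def algebra_iff_Un by blast
qed

lemma algebra_F_bar: "algebra (Omega_bar \<Omega>) (F_bar \<Omega> A)"
proof -
  interpret sigma_algebra \<Omega> "sigma_sets \<Omega> (union_alg A)"
    using A_subset by (intro sigma_algebra_sigma_sets) (auto simp: union_alg_def)
  show ?thesis
    unfolding algebra_iff_Un
  proof (intro conjI ballI)
    show "F_bar \<Omega> A \<subseteq> Pow (Omega_bar \<Omega>)"
      using sets_into_space by (auto simp: F_bar_def Omega_bar_def)
    show "{} \<in> F_bar \<Omega> A" unfolding F_bar_def by (auto intro!: exI[of _ "{}"])
    fix E assume "E \<in> F_bar \<Omega> A"
    then obtain E' where E: "E = E' \<times> {0..}" "E' \<in> sigma_sets \<Omega> (union_alg A)"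
      by (auto simp: F_bar_def)
    have "Omega_bar \<Omega> - E = (\<Omega> - E') \<times> {0..}" by (auto simp: E Omega_bar_def)
    then show "Omega_bar \<Omega> - E \<in> F_bar \<Omega> A" using E(2) unfolding F_bar_def by blast
    fix F assume "F \<in> F_bar \<Omega> A"
    then obtain F' where F: "F = F' \<times> {0..}" "F' \<in> sigma_sets \<Omega> (union_alg A)"
      by (auto simp: F_bar_def)
    have "E \<union> F = (E' \<union> F') \<times> {0..}" by (auto simp: E F)
    then show "E \<union> F \<in> F_bar \<Omega> A" using E(2) F(2) unfolding F_bar_def by blast
  qed
qed

lemma F_bar_subset: "F_bar \<Omega> A \<subseteq> Pow (Omega_bar \<Omega>)"
  using algebra_F_bar by (simp add: algebra_iff_Un)

lemma restr_F_bar: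
  assumes "x \<in> ba_pos (Pow (Omega_bar \<Omega>))"
  shows "restr (F_bar \<Omega> A) x \<in> ba_pos (F_bar \<Omega> A)"
proof (rule ba_pos_I[OF algebra_F_bar])
  fix E F assume EF: "E \<in> F_bar \<Omega> A" "F \<in> F_bar \<Omega> A" "E \<inter> F = {}"
  moreover from this have "E \<union> F \<in> F_bar \<Omega> A" using algebra_F_bar by (simp add: algebra_iff_Un)
  ultimately show "restr (F_bar \<Omega> A) x (E \<union> F) = restr (F_bar \<Omega> A) x E + restr (F_bar \<Omega> A) x F"
    using ba_Un[OF ba_pos_D(1)[OF assms], of E F] F_bar_subset by (auto simp: restr_def)
qed (auto simp: restr_def ba_pos_D(2)[OF assms])

lemma Omega_bar_in_F_bar: "Omega_bar \<Omega> \<in> F_bar \<Omega> A"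
  using algebra.top[OF algebra_F_bar] .

lemma restr_section:
  assumes x: "x \<in> ba_pos (Pow (Omega_bar \<Omega>))" and t: "0 \<le> t" and I: "I \<subseteq> {0..}"
  shows "restr (A t) (\<lambda>F. x (F \<times> I)) \<in> ba_pos (A t)"
proof (rule ba_pos_I[OF alg[OF t]])
  fix E F assume EF: "E \<in> A t" "F \<in> A t" "E \<inter> F = {}"
  moreover from this have "E \<union> F \<in> A t" using alg[OF t] by (simp add: algebra_iff_Un)
  ultimately show "restr (A t) (\<lambda>F. x (F \<times> I)) (E \<union> F) =
      restr (A t) (\<lambda>F. x (F \<times> I)) E + restr (A t) (\<lambda>F. x (F \<times> I)) F"
    using rectangle_Un[OF ba_pos_D(1)[OF x] A_subset[OF t] A_subset[OF t] _ I, of E F]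
    by (auto simp: restr_def)
qed (auto simp: restr_def ba_pos_D(2)[OF x])

section \<open>Potentials and their representation\<close>

text \<open>
  Only the values \<open>\<pi> t F\<close> with \<open>t \<ge> 0\<close> and \<open>F \<in> A t\<close> enter. Positivity of these values follows from
  the monotone convergence to \<open>0\<close>.
\<close>

definition potential :: "(real \<Rightarrow> 'a set \<Rightarrow> real) \<Rightarrow> bool" where
  "potential \<pi> \<longleftrightarrow>
    (\<forall>t\<ge>0. \<forall>E\<in>A t. \<forall>F\<in>A t. E \<inter> F = {} \<longrightarrow> \<pi> t (E \<union> F) = \<pi> t E + \<pi> t F) \<and>
    (\<forall>t\<ge>0. \<forall>u\<ge>t. \<forall>F\<in>A t. \<pi> u F \<le> \<pi> t F) \<and>
    (\<forall>t\<ge>0. \<forall>F\<in>A t. ((\<lambda>u. \<pi> u F) \<longlongrightarrow> 0) at_top)"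

lemma potential_Un:
  "potential \<pi> \<Longrightarrow> 0 \<le> t \<Longrightarrow> E \<in> A t \<Longrightarrow> F \<in> A t \<Longrightarrow> E \<inter> F = {} \<Longrightarrow> \<pi> t (E \<union> F) = \<pi> t E + \<pi> t F"
  by (simp add: potential_def)

lemma potential_antimono: "potential \<pi> \<Longrightarrow> 0 \<le> t \<Longrightarrow> t \<le> u \<Longrightarrow> F \<in> A t \<Longrightarrow> \<pi> u F \<le> \<pi> t F"
  by (simp add: potential_def)

lemma potential_tendsto: "potential \<pi> \<Longrightarrow> 0 \<le> t \<Longrightarrow> F \<in> A t \<Longrightarrow> ((\<lambda>u. \<pi> u F) \<longlongrightarrow> 0) at_top"
  by (auto simp: potential_def)

lemma potential_nonneg:
  assumes "potential \<pi>" "0 \<le> t" "F \<in> A t"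
  shows "0 \<le> \<pi> t F"
  using potential_tendsto[OF assms] potential_antimono[OF assms(1,2) _ assms(3)]
  by (intro tendsto_upperbound[of "\<lambda>u. \<pi> u F" 0 at_top])
    (auto intro!: eventually_at_top_linorderI[of t])

lemma potential_increment:
  assumes \<pi>: "potential \<pi>" and t: "0 \<le> t" "t \<le> u"
  shows "restr (A t) (\<lambda>F. \<pi> t F - \<pi> u F) \<in> ba_pos (A t)"
proof (rule ba_pos_I[OF alg[OF t(1)]])
  fix E F assume EF: "E \<in> A t" "F \<in> A t" "E \<inter> F = {}"
  moreover from this have "E \<union> F \<in> A t" using alg[OF t(1)] by (simp add: algebra_iff_Un)
  moreover have "E \<in> A u" "F \<in> A u" using EF mono[OF t] by auto
  ultimately show "restr (A t) (\<lambda>F. \<pi> t F - \<pi> u F) (E \<union> F) =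
      restr (A t) (\<lambda>F. \<pi> t F - \<pi> u F) E + restr (A t) (\<lambda>F. \<pi> t F - \<pi> u F) F"
    using potential_Un[OF \<pi>] t by (simp add: restr_def)
qed (use potential_antimono[OF \<pi> t] in \<open>auto simp: restr_def\<close>)

lemma potential_mono:
  assumes \<pi>: "potential \<pi>" and t: "0 \<le> t" and F: "F \<in> A t"
  shows "\<pi> t F \<le> \<pi> t \<Omega>"
proof -
  have D: "\<Omega> - F \<in> A t" using alg[OF t] F by (simp add: algebra_iff_Un)
  have "F \<union> (\<Omega> - F) = \<Omega>" using A_subset[OF t F] by auto
  then show ?thesis
    using potential_Un[OF \<pi> t F D] potential_nonneg[OF \<pi> t D] by simp
qed

lemma potential_frakM:
  assumes x: "x \<in> frakM \<Omega>"
  shows "potential (\<lambda>t F. x (F \<times> {t<..}))"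
  unfolding potential_def
proof (intro conjI allI impI ballI)
  fix t :: real assume t: "0 \<le> t"
  note M = frakM_D[OF x]
  show "x ((E \<union> F) \<times> {t<..}) = x (E \<times> {t<..}) + x (F \<times> {t<..})"
    if "E \<in> A t" "F \<in> A t" "E \<inter> F = {}" for E F
    using that t A_subset[OF t] by (intro rectangle_Un[OF M(2)]) auto
  fix F assume F: "F \<in> A t"
  show "x (F \<times> {u<..}) \<le> x (F \<times> {t<..})" if "t \<le> u" for u
    using that t A_subset[OF t F] by (intro rectangle_mono[OF M(1)]) auto
  show "((\<lambda>u. x (F \<times> {u<..})) \<longlongrightarrow> 0) at_top"
    by (rule frakM_tendsto(1)[OF x A_subset[OF t F]])
qed

lemma potential_minus:
  assumes \<pi>: "potential \<pi>" and x: "x \<in> frakM \<Omega>"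
    and le: "\<And>t u F. 0 \<le> t \<Longrightarrow> t < u \<Longrightarrow> F \<in> A t \<Longrightarrow> x (F \<times> {t<..u}) \<le> \<pi> t F - \<pi> u F"
  shows "potential (\<lambda>t F. \<pi> t F - x (F \<times> {t<..}))"
  unfolding potential_def
proof (intro conjI allI impI ballI)
  fix t :: real assume t: "0 \<le> t"
  note px = potential_frakM[OF x]
  show "\<pi> t (E \<union> F) - x ((E \<union> F) \<times> {t<..}) =
      \<pi> t E - x (E \<times> {t<..}) + (\<pi> t F - x (F \<times> {t<..}))"
    if "E \<in> A t" "F \<in> A t" "E \<inter> F = {}" for E F
    using potential_Un[OF \<pi> t that] potential_Un[OF px t that] by simp
  fix F assume F: "F \<in> A t"
  show "\<pi> u F - x (F \<times> {u<..}) \<le> \<pi> t F - x (F \<times> {t<..})" if u: "t \<le> u" for u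
    using rectangle_split(1)[OF frakM_D(2)[OF x] A_subset[OF t F] t u] le[OF t _ F, of u] u
    by (cases "t = u") auto
  show "((\<lambda>u. \<pi> u F - x (F \<times> {u<..})) \<longlongrightarrow> 0) at_top"
    using tendsto_diff[OF potential_tendsto[OF \<pi> t F] potential_tendsto[OF px t F]] by simp
qed

text \<open>
  The increments of a potential prescribe the masses of the rectangles on each strip separately,
  and the prescriptions on adjacent strips are compatible because the algebras increase.
\<close>

theorem potential_representation:
  assumes \<pi>: "potential \<pi>"
  shows "\<exists>x\<in>frakM \<Omega>. x (\<Omega> \<times> {0}) = 0 \<and> (\<forall>t\<ge>0. \<forall>F\<in>A t. x (F \<times> {t<..}) = \<pi> t F)"
proof -
  let ?X = "Omega_bar \<Omega>"
  define C where "C t u x \<longleftrightarrow> (\<forall>F. F \<in> A t \<longrightarrow> x (F \<times> {t<..u}) = \<pi> t F - \<pi> u F)"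
    for t u and x :: "('a \<times> real) set \<Rightarrow> real"
  have "\<exists>x\<in>frakM \<Omega>. x (\<Omega> \<times> {0}) = 0 \<and> (\<forall>t u. 0 \<le> t \<longrightarrow> t < u \<longrightarrow> C t u x)"
  proof (rule strip_gluing[where M = "\<pi> 0 \<Omega>"])
    fix t u :: real assume t: "0 \<le> t" and u: "t < u"
    have "fst ` (\<Omega> \<times> {t<..u}) = \<Omega>" using u by force
    from extension_exists[OF alg[OF t] this potential_increment[OF \<pi> t less_imp_le[OF u]]]
    obtain y where y: "y \<in> ba_pos (Pow (\<Omega> \<times> {t<..u}))"
      "\<And>F. F \<in> A t \<Longrightarrow> y (\<Omega> \<times> {t<..u} \<inter> fst -` F) = \<pi> t F - \<pi> u F"
      by (auto simp: restr_def)
    define x where "x = restr (Pow ?X) (\<lambda>B. y (B \<inter> \<Omega> \<times> {t<..u}))"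
    have "x \<in> ba_pos (Pow ?X)" unfolding x_def by (rule ba_pos_trace[OF y(1)]) auto
    moreover have "C t u x"
      unfolding C_def
    proof (intro allI impI)
      fix F assume F: "F \<in> A t"
      have "F \<times> {t<..u} \<inter> \<Omega> \<times> {t<..u} = \<Omega> \<times> {t<..u} \<inter> fst -` F" by auto
      moreover have "F \<times> {t<..u} \<subseteq> ?X" using A_subset[OF t F] t by (auto simp: Omega_bar_def)
      ultimately show "x (F \<times> {t<..u}) = \<pi> t F - \<pi> u F"
        using y(2)[OF F] by (simp add: x_def restr_def)
    qed
    ultimately show "\<exists>x\<in>ba_pos (Pow ?X). C t u x" by blast
  next
    fix t u :: real and x y :: "('a \<times> real) set \<Rightarrow> real"
    assume t: "0 \<le> t" and x: "C t u x" and eq: "\<And>B. B \<subseteq> \<Omega> \<times> {t<..u} \<Longrightarrow> y B = x B"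
    have "y (F \<times> {t<..u}) = x (F \<times> {t<..u})" if "F \<in> A t" for F
      using A_subset[OF t that] by (intro eq) auto
    then show "C t u y" using x by (simp add: C_def)
  next
    fix t u v :: real and x :: "('a \<times> real) set \<Rightarrow> real"
    assume t: "0 \<le> t" and u: "t < u" "u < v" and x: "x \<in> ba_pos (Pow ?X)" "C t u x" "C u v x"
    show "C t v x"
      unfolding C_def
    proof (intro allI impI)
      fix F assume F: "F \<in> A t"
      then have "F \<in> A u" using mono[of t u] t u by auto
      then show "x (F \<times> {t<..v}) = \<pi> t F - \<pi> v F"
        using x(2,3) F rectangle_split(2)[OF ba_pos_D(1)[OF x(1)] A_subset[OF t F] t, of u v] u
        by (simp add: C_def)
    qed
  next
    show "closed {x. C t u x}" for t u
      unfolding C_def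
      by (intro closed_Collect_all closed_Collect_imp open_Collect_const closed_Collect_eq
          continuous_on_product_coordinates continuous_intros)
  next
    fix u :: real and x assume "0 < u" "C 0 u x"
    then show "x (\<Omega> \<times> {0<..u}) \<le> \<pi> 0 \<Omega>"
      using space_in_A[of 0] space_in_A[of u] potential_nonneg[OF \<pi>, of u \<Omega>] by (simp add: C_def)
  qed
  then obtain x where x: "x \<in> frakM \<Omega>" "x (\<Omega> \<times> {0}) = 0" "\<And>t u. 0 \<le> t \<Longrightarrow> t < u \<Longrightarrow> C t u x"
    by blast
  have "x (F \<times> {t<..}) = \<pi> t F" if t: "0 \<le> t" and F: "F \<in> A t" for t F
  proof (rule tendsto_unique[OF trivial_limit_at_top_linorder])
    show "((\<lambda>u. x (F \<times> {t<..u})) \<longlongrightarrow> x (F \<times> {t<..})) at_top"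
      by (rule frakM_tendsto(2)[OF x(1) A_subset[OF t F] t])
    have "((\<lambda>u. \<pi> t F - \<pi> u F) \<longlongrightarrow> \<pi> t F - 0) at_top"
      by (intro tendsto_intros potential_tendsto[OF \<pi> t F])
    moreover have "\<forall>\<^sub>F u in at_top. \<pi> t F - \<pi> u F = x (F \<times> {t<..u})"
      using x(3)[OF t] F by (auto simp: C_def intro!: eventually_at_top_linorderI[of "t + 1"])
    ultimately show "((\<lambda>u. x (F \<times> {t<..u})) \<longlongrightarrow> \<pi> t F) at_top"
      by (simp add: tendsto_cong)
  qed
  then show ?thesis using x by blast
qed

text \<open>
  The hypothesis says that \<open>z1 + w1\<close> and \<open>z2 + w2\<close> represent the same potential. So on the rectangles
  \<open>z1 - z2 = w2 - w1\<close>, which is below both \<open>z1\<close> and \<open>w2\<close>. The positive part of this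
  difference, taken on each strip within the algebra at the left end of the strip, is
  therefore below both as well. It extends to all subsets of the strip without exceeding \<open>z1\<close>, and
  the extensions are glued. Domination by \<open>w2\<close> is available on rectangles only, since
  that is where the two representations agree.
\<close>

lemma common_part_exists:
  assumes z: "z1 \<in> frakM \<Omega>" "z2 \<in> frakM \<Omega>" and w: "w1 \<in> frakM \<Omega>" "w2 \<in> frakM \<Omega>"
    and eq: "\<And>t F. 0 \<le> t \<Longrightarrow> F \<in> A t \<Longrightarrow>
      z1 (F \<times> {t<..}) + w1 (F \<times> {t<..}) = z2 (F \<times> {t<..}) + w2 (F \<times> {t<..})"
  shows "\<exists>x\<in>frakM \<Omega>. x (\<Omega> \<times> {0}) = 0 \<and> (\<forall>B. x B \<le> z1 B) \<and>
    (\<forall>t u. 0 \<le> t \<longrightarrow> t < u \<longrightarrow> (\<forall>F\<in>A t. z1 (F \<times> {t<..u}) - z2 (F \<times> {t<..u}) \<le> x (F \<times> {t<..u}) \<and>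
      x (F \<times> {t<..u}) \<le> w2 (F \<times> {t<..u})))"
proof -
  let ?X = "Omega_bar \<Omega>"
  note z1 = frakM_D[OF z(1)] and z2 = frakM_D[OF z(2)]
  note w1 = frakM_D[OF w(1)] and w2 = frakM_D[OF w(2)]
  define C where "C t u x \<longleftrightarrow>
      (\<forall>F. F \<in> A t \<longrightarrow> z1 (F \<times> {t<..u}) - z2 (F \<times> {t<..u}) \<le> x (F \<times> {t<..u}) \<and>
        x (F \<times> {t<..u}) \<le> w2 (F \<times> {t<..u})) \<and>
      (\<forall>B. B \<subseteq> \<Omega> \<times> {t<..u} \<longrightarrow> x B \<le> z1 B)"
    for t u and x :: "('a \<times> real) set \<Rightarrow> real"
  have "\<exists>x\<in>frakM \<Omega>. x (\<Omega> \<times> {0}) = 0 \<and> (\<forall>t u. 0 \<le> t \<longrightarrow> t < u \<longrightarrow> C t u x)"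
  proof (rule strip_gluing[where M = "z1 ?X"])
    fix t u :: real assume t: "0 \<le> t" and u: "t < u"
    have I: "{t<..u} \<subseteq> {0..}" using t by auto
    let ?r = "\<lambda>x. restr (A t) (\<lambda>F. x (F \<times> {t<..u}))"
    have r: "?r x \<in> ba (A t)" if "x \<in> ba_pos (Pow ?X)" for x
      using restr_section[OF that t I] by (rule ba_pos_D(1))
    define m where "m = (\<lambda>F. ?r z1 F - ?r z2 F)"
    have m: "m \<in> ba (A t)" unfolding m_def by (intro ba_diff r z1 z2)
    define \<mu> where "\<mu> = ba_sup (A t) m (\<lambda>_. 0)"
    note s = ba_sup_D[OF alg[OF t] m ba_zero, folded \<mu>_def]
    have \<mu>: "\<mu> \<in> ba_pos (A t)" using s(1,3) by (simp add: ba_pos_def)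
    have m_le: "m F \<le> ?r z1 F" "m F \<le> ?r w2 F" if F: "F \<in> A t" for F
    proof -
      have "F \<in> A u" using F mono[of t u] t u by auto
      then show "m F \<le> ?r z1 F" "m F \<le> ?r w2 F"
        using F eq[OF t F] eq[of u F] t u
          rectangle_split(1)[OF z1(2) A_subset[OF t F] t, of u]
          rectangle_split(1)[OF z2(2) A_subset[OF t F] t, of u]
          rectangle_split(1)[OF w1(2) A_subset[OF t F] t, of u]
          rectangle_split(1)[OF w2(2) A_subset[OF t F] t, of u]
          ba_pos_D(2)[OF z2(1), of "F \<times> {t<..u}"] ba_pos_D(2)[OF w1(1), of "F \<times> {t<..u}"]
        by (simp_all add: m_def restr_def)
    qed
    have \<mu>_le: "\<mu> F \<le> x (F \<times> {t<..u})"
      if x: "x \<in> ba_pos (Pow ?X)" and "\<And>E. E \<in> A t \<Longrightarrow> m E \<le> ?r x E" and F: "F \<in> A t" for x F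
      using s(4)[OF r[OF x] that(2) _ F] ba_pos_D(2)[OF x] F by (simp add: restr_def)
    define \<nu> where "\<nu> = restr (Pow (\<Omega> \<times> {t<..u})) z1"
    have \<nu>: "\<nu> \<in> ba_pos (Pow (\<Omega> \<times> {t<..u}))"
      using ba_pos_trace[OF z1(1), of "\<Omega> \<times> {t<..u}" UNIV] I by (force simp: \<nu>_def Omega_bar_def)
    have rect: "\<Omega> \<times> {t<..u} \<inter> fst -` F = F \<times> {t<..u}" if "F \<in> A t" for F
      using A_subset[OF t that] by auto
    have le: "\<mu> F \<le> \<nu> (\<Omega> \<times> {t<..u} \<inter> fst -` F)" if "F \<in> A t" for F
      using \<mu>_le[OF z1(1) m_le(1) that] A_subset[OF t that]
      by (auto simp: rect[OF that] \<nu>_def restr_def)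
    have "fst ` (\<Omega> \<times> {t<..u}) \<subseteq> \<Omega>" by auto
    from dominated_extension_exists[OF alg[OF t] this \<mu> \<nu> le]
    obtain y where y: "y \<in> ba_pos (Pow (\<Omega> \<times> {t<..u}))" "\<And>B. y B \<le> \<nu> B"
      "\<And>F. F \<in> A t \<Longrightarrow> y (\<Omega> \<times> {t<..u} \<inter> fst -` F) = \<mu> F"
      by blast
    define x where "x = restr (Pow ?X) (\<lambda>B. y (B \<inter> \<Omega> \<times> {t<..u}))"
    have "x \<in> ba_pos (Pow ?X)" unfolding x_def by (rule ba_pos_trace[OF y(1)]) auto
    moreover have xy: "x B = y B" if "B \<subseteq> \<Omega> \<times> {t<..u}" for B
    proof -
      have "B \<subseteq> ?X" "B \<inter> \<Omega> \<times> {t<..u} = B" using that I by (force simp: Omega_bar_def)+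
      then show ?thesis by (simp add: x_def restr_def)
    qed
    moreover have "C t u x"
      unfolding C_def
    proof (intro conjI allI impI)
      show "x B \<le> z1 B" if "B \<subseteq> \<Omega> \<times> {t<..u}" for B
        using y(2)[of B] xy[OF that] that by (simp add: \<nu>_def restr_def)
      fix F assume F: "F \<in> A t"
      have x\<mu>: "x (F \<times> {t<..u}) = \<mu> F"
        using y(3)[OF F] xy[of "F \<times> {t<..u}"] A_subset[OF t F] by (auto simp: rect[OF F])
      show "z1 (F \<times> {t<..u}) - z2 (F \<times> {t<..u}) \<le> x (F \<times> {t<..u})"
        using s(2)[OF F] F by (simp add: x\<mu> m_def restr_def)
      show "x (F \<times> {t<..u}) \<le> w2 (F \<times> {t<..u})"
        unfolding x\<mu> by (rule \<mu>_le[OF w2(1) m_le(2) F])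
    qed
    ultimately show "\<exists>x\<in>ba_pos (Pow ?X). C t u x" by blast
  next
    fix t u :: real and x y :: "('a \<times> real) set \<Rightarrow> real"
    assume t: "0 \<le> t" and x: "C t u x" and eq: "\<And>B. B \<subseteq> \<Omega> \<times> {t<..u} \<Longrightarrow> y B = x B"
    have "y (F \<times> {t<..u}) = x (F \<times> {t<..u})" if "F \<in> A t" for F
      using A_subset[OF t that] by (intro eq) auto
    then show "C t u y" using x eq by (simp add: C_def)
  next
    fix t u v :: real and x :: "('a \<times> real) set \<Rightarrow> real"
    assume t: "0 \<le> t" and u: "t < u" "u < v" and x: "x \<in> ba_pos (Pow ?X)" "C t u x" "C u v x"
    show "C t v x"
      unfolding C_def
    proof (intro conjI allI impI)
      fix F assume F: "F \<in> A t"
      then have Fu: "F \<in> A u" using mono[of t u] t u by auto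
      have split: "k (F \<times> {t<..v}) = k (F \<times> {t<..u}) + k (F \<times> {u<..v})"
        if "k \<in> ba (Pow ?X)" for k
        using rectangle_split(2)[OF that A_subset[OF t F] t] u by simp
      show "z1 (F \<times> {t<..v}) - z2 (F \<times> {t<..v}) \<le> x (F \<times> {t<..v})"
        "x (F \<times> {t<..v}) \<le> w2 (F \<times> {t<..v})"
        using x(2,3) F Fu unfolding C_def
        by (smt (verit) split z1(2) z2(2) w2(2) ba_pos_D(1)[OF x(1)])+
    next
      fix B assume B: "B \<subseteq> \<Omega> \<times> {t<..v}"
      let ?S = "\<Omega> \<times> {t<..u}"
      have X: "B \<in> Pow ?X" "?S \<in> Pow ?X" using B t by (force simp: Omega_bar_def)+
      have "B \<inter> ?S \<subseteq> ?S" "B - ?S \<subseteq> \<Omega> \<times> {u<..v}" using B by force+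
      then have "x (B \<inter> ?S) \<le> z1 (B \<inter> ?S)" "x (B - ?S) \<le> z1 (B - ?S)"
        using x(2,3) by (auto simp: C_def)
      then show "x B \<le> z1 B"
        using ba_split[OF algebra_Pow ba_pos_D(1)[OF x(1)] X(2,1)] ba_split[OF algebra_Pow z1(2) X(2,1)]
        by simp
    qed
  next
    show "closed {x. C t u x}" for t u
      unfolding C_def
      by (intro closed_Collect_conj closed_Collect_all closed_Collect_imp open_Collect_const
          closed_Collect_le continuous_on_product_coordinates continuous_intros)
  next
    fix u :: real and x assume "0 < u" "C 0 u x"
    then have "x (\<Omega> \<times> {0<..u}) \<le> z1 (\<Omega> \<times> {0<..u})" by (simp add: C_def)
    also have "\<dots> \<le> z1 ?X" by (rule ba_pos_le_space[OF algebra_Pow z1(1)])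
    finally show "x (\<Omega> \<times> {0<..u}) \<le> z1 ?X" .
  qed
  then obtain x where x: "x \<in> frakM \<Omega>" "x (\<Omega> \<times> {0}) = 0" "\<And>t u. 0 \<le> t \<Longrightarrow> t < u \<Longrightarrow> C t u x"
    by blast
  have "x B \<le> z1 B" if "0 < u" "B \<subseteq> \<Omega> \<times> {0<..u}" for u B
    using x(3)[of 0 u] that unfolding C_def by simp
  then have "x B \<le> z1 B" for B
    by (rule frakM_le_if_le_on_strips[OF x(1,2) z1(1)])
  then show ?thesis using x unfolding C_def by blast
qed


section \<open>Norm-bounded supermartingales and their potentials\<close>

lemma frakS_iff:
  "\<xi> \<in> frakS A \<longleftrightarrow> fa_supermartingale A \<xi> \<and> (\<exists>c. \<forall>t\<ge>0. \<forall>F\<in>A t. \<bar>\<xi> t F\<bar> \<le> c)"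
proof
  assume \<xi>: "\<xi> \<in> frakS A"
  define S where "S = (SUP t\<in>{0..}. ba_norm (A t) (\<xi> t))"
  have S: "S < \<infinity>" using \<xi> by (simp add: frakS_def S_def)
  have le: "ereal \<bar>\<xi> t F\<bar> \<le> S" if "0 \<le> t" "F \<in> A t" for t F
    unfolding S_def using that by (intro SUP_upper2[of t] le_ba_norm) auto
  have "\<exists>c. \<forall>t\<ge>0. \<forall>F\<in>A t. \<bar>\<xi> t F\<bar> \<le> c"
  proof (cases S)
    case (real r)
    then show ?thesis using le by auto
  next
    case MInf
    then show ?thesis using le[of 0 \<Omega>] space_in_A by auto
  qed (use S in simp)
  then show "fa_supermartingale A \<xi> \<and> (\<exists>c. \<forall>t\<ge>0. \<forall>F\<in>A t. \<bar>\<xi> t F\<bar> \<le> c)"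
    using \<xi> by (simp add: frakS_def)
next
  assume R: "fa_supermartingale A \<xi> \<and> (\<exists>c. \<forall>t\<ge>0. \<forall>F\<in>A t. \<bar>\<xi> t F\<bar> \<le> c)"
  then obtain c where c: "\<And>t F. 0 \<le> t \<Longrightarrow> F \<in> A t \<Longrightarrow> \<bar>\<xi> t F\<bar> \<le> c" by blast
  have "(SUP t\<in>{0..}. ba_norm (A t) (\<xi> t)) \<le> ereal (2 * c)"
  proof (rule SUP_least)
    fix t :: real assume "t \<in> {0..}"
    then show "ba_norm (A t) (\<xi> t) \<le> ereal (2 * c)"
      using R c by (intro ba_norm_le[OF alg]) (auto simp: fa_supermartingale_def)
  qed
  then show "\<xi> \<in> frakS A"
    using R by (auto simp: frakS_def)
qed

lemma frakS_D:
  assumes "\<xi> \<in> frakS A"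
  shows "0 \<le> t \<Longrightarrow> \<xi> t \<in> ba (A t)"
    and "\<not> (0 \<le> t \<and> F \<in> A t) \<Longrightarrow> \<xi> t F = 0"
    and "0 \<le> t \<Longrightarrow> t \<le> u \<Longrightarrow> F \<in> A t \<Longrightarrow> \<xi> u F \<le> \<xi> t F"
proof -
  note S = assms[unfolded frakS_def fa_supermartingale_def]
  show ba: "\<xi> t \<in> ba (A t)" if "0 \<le> t" for t using S that by simp
  show "\<xi> t F = 0" if "\<not> (0 \<le> t \<and> F \<in> A t)"
    using S ba[of t] that by (cases "0 \<le> t") (auto simp: ba_def not_le)
  show "\<xi> u F \<le> \<xi> t F" if "0 \<le> t" "t \<le> u" "F \<in> A t" using S that by simp
qed

lemma xi_inf_tendsto:
  assumes \<xi>: "\<xi> \<in> frakS A" and t: "0 \<le> t" and F: "F \<in> A t"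
  shows "((\<lambda>u. \<xi> u F) \<longlongrightarrow> xi_inf A \<xi> F) at_top"
proof -
  obtain c where c: "\<And>t F. 0 \<le> t \<Longrightarrow> F \<in> A t \<Longrightarrow> \<bar>\<xi> t F\<bar> \<le> c"
    using \<xi> unfolding frakS_iff by blast
  let ?T = "{t. 0 \<le> t \<and> F \<in> A t}"
  have bdd: "bdd_below ((\<lambda>t. \<xi> t F) ` ?T)"
    using c by (intro bdd_belowI[of _ "- c"]) (force simp: abs_le_iff)
  have xi: "xi_inf A \<xi> F = (INF t\<in>?T. \<xi> t F)"
    using t F by (auto simp: xi_inf_def restr_def union_alg_def)
  have le: "xi_inf A \<xi> F \<le> \<xi> u F" if "t \<le> u" for u
    unfolding xi using that t F mono[of t u] by (intro cINF_lower[OF bdd]) auto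
  show ?thesis
  proof (rule order_tendstoI)
    fix a assume "a < xi_inf A \<xi> F"
    then show "\<forall>\<^sub>F u in at_top. a < \<xi> u F"
      using le by (auto intro!: eventually_at_top_linorderI[of t] intro: less_le_trans)
  next
    fix a assume "xi_inf A \<xi> F < a"
    then obtain s where s: "0 \<le> s" "F \<in> A s" "\<xi> s F < a"
      unfolding xi using t F by (subst (asm) cINF_less_iff[OF _ bdd]) auto
    then show "\<forall>\<^sub>F u in at_top. \<xi> u F < a"
      using frakS_D(3)[OF \<xi> s(1) _ s(2)]
      by (auto intro!: eventually_at_top_linorderI[of s] intro: le_less_trans)
  qed
qed

lemma xi_inf_ba:
  assumes \<xi>: "\<xi> \<in> frakS A"
  shows "xi_inf A \<xi> \<in> ba (union_alg A)"
proof -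
  obtain c where c: "\<And>t F. 0 \<le> t \<Longrightarrow> F \<in> A t \<Longrightarrow> \<bar>\<xi> t F\<bar> \<le> c"
    using \<xi> unfolding frakS_iff by blast
  have "xi_inf A \<xi> (E \<union> F) = xi_inf A \<xi> E + xi_inf A \<xi> F"
    if EF: "E \<in> union_alg A" "F \<in> union_alg A" "E \<inter> F = {}" for E F
  proof -
    obtain t u where t: "0 \<le> t" "E \<in> A t" and u: "0 \<le> u" "F \<in> A u"
      using EF by (auto simp: union_alg_def)
    have in_A: "E \<in> A s" "F \<in> A s" "0 \<le> s" if "max t u \<le> s" for s
      using that t u mono[of t s] mono[of u s] by auto
    have Un: "E \<union> F \<in> A (max t u)"
      using in_A[of "max t u"] alg[of "max t u"] by (simp add: algebra_iff_Un)
    show ?thesis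
    proof (rule tendsto_unique[OF trivial_limit_at_top_linorder])
      show "((\<lambda>s. \<xi> s (E \<union> F)) \<longlongrightarrow> xi_inf A \<xi> (E \<union> F)) at_top"
        using xi_inf_tendsto[OF \<xi> _ Un] t by simp
      have "((\<lambda>s. \<xi> s E + \<xi> s F) \<longlongrightarrow> xi_inf A \<xi> E + xi_inf A \<xi> F) at_top"
        by (rule tendsto_add[OF xi_inf_tendsto[OF \<xi> t] xi_inf_tendsto[OF \<xi> u]])
      moreover have "\<forall>\<^sub>F s in at_top. \<xi> s E + \<xi> s F = \<xi> s (E \<union> F)"
        using ba_Un[OF frakS_D(1)[OF \<xi>] _ _ EF(3)] in_A
        by (auto intro!: eventually_at_top_linorderI[of "max t u"])
      ultimately show "((\<lambda>s. \<xi> s (E \<union> F)) \<longlongrightarrow> xi_inf A \<xi> E + xi_inf A \<xi> F) at_top"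
        by (simp add: tendsto_cong)
    qed
  qed
  moreover have "\<bar>xi_inf A \<xi> F\<bar> \<le> c" if F: "F \<in> union_alg A" for F
  proof -
    obtain t where t: "0 \<le> t" "F \<in> A t" using F by (auto simp: union_alg_def)
    have "\<forall>\<^sub>F u in at_top. \<bar>\<xi> u F\<bar> \<le> c"
      using t mono c by (intro eventually_at_top_linorderI[of t]) (meson order_trans subsetD)
    then show ?thesis
      by (rule tendsto_upperbound[OF tendsto_rabs[OF xi_inf_tendsto[OF \<xi> t]]]) simp
  qed
  moreover have "xi_inf A \<xi> F = 0" if "F \<notin> union_alg A" for F
    using that by (simp add: xi_inf_def restr_def)
  ultimately show ?thesis
    unfolding ba_def additive_def by blast
qed

lemma potential_of_frakS:
  assumes \<xi>: "\<xi> \<in> frakS A"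
  shows "potential (\<lambda>t F. \<xi> t F - xi_inf A \<xi> F)"
  unfolding potential_def
proof (intro conjI allI impI ballI)
  fix t :: real assume t: "0 \<le> t"
  have U: "F \<in> union_alg A" if "F \<in> A t" for F using that t by (auto simp: union_alg_def)
  show "\<xi> t (E \<union> F) - xi_inf A \<xi> (E \<union> F) = \<xi> t E - xi_inf A \<xi> E + (\<xi> t F - xi_inf A \<xi> F)"
    if "E \<in> A t" "F \<in> A t" "E \<inter> F = {}" for E F
    using ba_Un[OF frakS_D(1)[OF \<xi> t] that]
      ba_Un[OF xi_inf_ba[OF \<xi>] U[OF that(1)] U[OF that(2)] that(3)] by simp
  fix F assume F: "F \<in> A t"
  show "\<xi> u F - xi_inf A \<xi> F \<le> \<xi> t F - xi_inf A \<xi> F" if "t \<le> u" for u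
    using frakS_D(3)[OF \<xi> t that F] by simp
  show "((\<lambda>u. \<xi> u F - xi_inf A \<xi> F) \<longlongrightarrow> 0) at_top"
    using tendsto_diff[OF xi_inf_tendsto[OF \<xi> t F] tendsto_const[of "xi_inf A \<xi> F"]] by simp
qed

lemma frakS_of_potential:
  assumes m: "m \<in> ba (union_alg A)" and \<rho>: "potential \<rho>"
  defines "\<zeta> \<equiv> \<lambda>t F. if 0 \<le> t \<and> F \<in> A t then m F + \<rho> t F else 0"
  shows "\<zeta> \<in> frakS A" "xi_inf A \<zeta> = m"
proof -
  obtain c where c: "\<And>F. F \<in> union_alg A \<Longrightarrow> \<bar>m F\<bar> \<le> c" using m unfolding ba_def by blast
  have U: "F \<in> union_alg A" if "0 \<le> t" "F \<in> A t" for F t using that by (auto simp: union_alg_def)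
  have bd: "\<bar>\<zeta> t F\<bar> \<le> c + \<rho> 0 \<Omega>" if t: "0 \<le> t" and F: "F \<in> A t" for t F
    using c[OF U[OF t F]] potential_nonneg[OF \<rho> t F] potential_mono[OF \<rho> t F]
      potential_antimono[OF \<rho> _ t space_in_A] t F by (auto simp: \<zeta>_def)
  have "\<zeta> t \<in> ba (A t)" if t: "0 \<le> t" for t
  proof -
    have "\<zeta> t (E \<union> F) = \<zeta> t E + \<zeta> t F" if EF: "E \<in> A t" "F \<in> A t" "E \<inter> F = {}" for E F
    proof -
      have "E \<union> F \<in> A t" using alg[OF t] EF by (simp add: algebra_iff_Un)
      then show ?thesis
        using ba_Un[OF m U[OF t EF(1)] U[OF t EF(2)] EF(3)] potential_Un[OF \<rho> t EF] EF t
        by (simp add: \<zeta>_def)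
    qed
    moreover have "\<exists>c. \<forall>F\<in>A t. \<bar>\<zeta> t F\<bar> \<le> c" using bd[OF t] by blast
    moreover have "\<forall>F. F \<notin> A t \<longrightarrow> \<zeta> t F = 0" by (simp add: \<zeta>_def)
    ultimately show ?thesis unfolding ba_def additive_def by blast
  qed
  moreover have "\<zeta> u F \<le> \<zeta> t F" if "0 \<le> t" "t \<le> u" "F \<in> A t" for t u F
    using that mono[of t u] potential_antimono[OF \<rho> that] by (auto simp: \<zeta>_def)
  moreover have "\<zeta> t = (\<lambda>_. 0)" if "t < 0" for t
    using that by (simp add: \<zeta>_def)
  ultimately show \<zeta>: "\<zeta> \<in> frakS A"
    using bd unfolding frakS_iff fa_supermartingale_def by blast
  show "xi_inf A \<zeta> = m"
  proof (rule ba_eqI[OF xi_inf_ba[OF \<zeta>] m])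
    fix F assume "F \<in> union_alg A"
    then obtain t where t: "0 \<le> t" "F \<in> A t" by (auto simp: union_alg_def)
    have "((\<lambda>u. m F + \<rho> u F) \<longlongrightarrow> m F + 0) at_top"
      by (intro tendsto_intros potential_tendsto[OF \<rho> t])
    moreover have "\<forall>\<^sub>F u in at_top. m F + \<rho> u F = \<zeta> u F"
    proof (rule eventually_at_top_linorderI[of t])
      fix u assume "t \<le> u"
      then show "m F + \<rho> u F = \<zeta> u F" using t mono[of t u] by (auto simp: \<zeta>_def)
    qed
    ultimately have "((\<lambda>u. \<zeta> u F) \<longlongrightarrow> m F) at_top"
      by (simp add: tendsto_cong)
    then show "xi_inf A \<zeta> F = m F"
      by (rule tendsto_unique[OF trivial_limit_at_top_linorder xi_inf_tendsto[OF \<zeta> t]])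
  qed
qed

section \<open>The decomposition\<close>

text \<open>
  These are the countably additive set functions whose potential leaves a potential when it is
  subtracted from \<open>\<pi>\<close>. The conditions on rectangles do not bound the mass of \<open>\<Omega> \<times> {0}\<close>, which is
  therefore fixed to be \<open>0\<close>; otherwise this mass could always be increased.
\<close>

definition uc_minorants :: "(real \<Rightarrow> 'a set \<Rightarrow> real) \<Rightarrow> (('a \<times> real) set \<Rightarrow> real) set" where
  "uc_minorants \<pi> = {x \<in> frakM_uc \<Omega> A. x (\<Omega> \<times> {0}) = 0 \<and>
     (\<forall>t u. 0 \<le> t \<longrightarrow> t < u \<longrightarrow> (\<forall>F\<in>A t. x (F \<times> {t<..u}) \<le> \<pi> t F - \<pi> u F))}"

lemma uc_minorants_D:
  assumes "x \<in> uc_minorants \<pi>"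
  shows "x \<in> frakM_uc \<Omega> A" "x \<in> frakM \<Omega>" "x (\<Omega> \<times> {0}) = 0" "restr (F_bar \<Omega> A) x \<in> ca (F_bar \<Omega> A)"
    "\<And>t u F. 0 \<le> t \<Longrightarrow> t < u \<Longrightarrow> F \<in> A t \<Longrightarrow> x (F \<times> {t<..u}) \<le> \<pi> t F - \<pi> u F"
  using assms by (auto simp: uc_minorants_def frakM_uc_def)

lemma mass_eq:
  assumes "x \<in> ba (Pow (Omega_bar \<Omega>))"
  shows "x (Omega_bar \<Omega>) = x (\<Omega> \<times> {0}) + x (\<Omega> \<times> {0<..})"
proof -
  have "Omega_bar \<Omega> = \<Omega> \<times> {0} \<union> \<Omega> \<times> {0<..}" by (auto simp: Omega_bar_def)
  moreover have "\<Omega> \<times> {0} \<inter> \<Omega> \<times> {0::real<..} = {}" by auto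
  moreover have "{0} \<subseteq> {0::real..}" "{0<..} \<subseteq> {0::real..}" by auto
  ultimately show ?thesis
    using ba_Un[OF assms rectangle_in[OF order_refl] rectangle_in[OF order_refl]] by simp
qed

lemma uc_minorants_le:
  assumes \<pi>: "potential \<pi>" and x: "x \<in> uc_minorants \<pi>"
  shows "0 \<le> t \<Longrightarrow> x (\<Omega> \<times> {t<..}) \<le> \<pi> t \<Omega>" and "x (Omega_bar \<Omega>) \<le> \<pi> 0 \<Omega>"
proof -
  note D = uc_minorants_D[OF x]
  note p = potential_minus[OF \<pi> D(2) D(5)]
  show le: "x (\<Omega> \<times> {t<..}) \<le> \<pi> t \<Omega>" if "0 \<le> t" for t
    using potential_nonneg[OF p that space_in_A[OF that]] by simp
  show "x (Omega_bar \<Omega>) \<le> \<pi> 0 \<Omega>"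
    using mass_eq[OF frakM_D(2)[OF D(2)]] D(3) le[of 0] by simp
qed

text \<open>
  The mass of a minorant is at most \<open>\<pi> 0 \<Omega>\<close>, so the setwise supremum of a chain of minorants is finite
  and again a minorant, and Zorn's lemma applies.
\<close>

lemma maximal_uc_minorant_exists:
  assumes \<pi>: "potential \<pi>"
  shows "\<exists>s\<in>uc_minorants \<pi>. \<forall>x\<in>uc_minorants \<pi>. (\<forall>B. s B \<le> x B) \<longrightarrow> x = s"
proof (rule predicate_Zorn)
  show "partial_order_on (uc_minorants \<pi>) (relation_of (\<lambda>x y. \<forall>B. x B \<le> y B) (uc_minorants \<pi>))"
    by (rule partial_order_on_relation_ofI) (auto intro: order_trans antisym simp: fun_eq_iff)
  fix C assume C: "C \<in> Chains (relation_of (\<lambda>x y. \<forall>B. x B \<le> y B) (uc_minorants \<pi>))"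
  let ?X = "Omega_bar \<Omega>" and ?G = "F_bar \<Omega> A"
  have sub: "x \<in> uc_minorants \<pi>" if "x \<in> C" for x
    using C that unfolding Chains_def relation_of_def by blast
  have chain: "(\<forall>B. x B \<le> y B) \<or> (\<forall>B. y B \<le> x B)" if "x \<in> C" "y \<in> C" for x y
    using C that unfolding Chains_def relation_of_def by blast
  show "\<exists>u\<in>uc_minorants \<pi>. \<forall>a\<in>C. \<forall>B. a B \<le> u B"
  proof (cases "C = {}")
    case True
    have "(\<lambda>_. 0) \<in> uc_minorants \<pi>"
      using potential_antimono[OF \<pi>] ca_zero
      by (auto simp: uc_minorants_def frakM_uc_def frakM_def ba_pos_zero restr_def)
    then show ?thesis using True by blast
  next
    case ne: False
    note D = uc_minorants_D[OF sub]
    define s where "s = (\<lambda>B. SUP x\<in>C. x B)"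
    have pos: "C \<subseteq> ba_pos (Pow ?X)" using D(2) frakM_D(1) by blast
    have bd: "\<forall>x\<in>C. x ?X \<le> \<pi> 0 \<Omega>" using uc_minorants_le(2)[OF \<pi> sub] by blast
    have dir: "\<forall>k\<in>C. \<forall>l\<in>C. \<exists>n\<in>C. \<forall>F\<in>Pow ?X. k F \<le> n F \<and> l F \<le> n F"
      using chain by (meson order_refl)
    have s_ge: "x B \<le> s B" if "x \<in> C" for x B
      unfolding s_def using directed_SUP(1)[OF algebra_Pow ne pos bd dir that] .
    have s: "s \<in> ba_pos (Pow ?X)"
      unfolding s_def by (rule directed_SUP(2)[OF algebra_Pow ne pos bd dir])
    have s_le: "s B \<le> c" if "\<And>x. x \<in> C \<Longrightarrow> x B \<le> c" for B c
      unfolding s_def using ne that by (intro cSUP_least) auto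
    have "s \<in> frakM \<Omega>"
    proof -
      have "((\<lambda>t. s (\<Omega> \<times> {t<..})) \<longlongrightarrow> 0) at_top"
      proof (rule tendsto_sandwich[of "\<lambda>_. 0"])
        show "((\<lambda>t. \<pi> t \<Omega>) \<longlongrightarrow> 0) at_top"
          using potential_tendsto[OF \<pi> _ space_in_A[of 0]] by simp
        show "\<forall>\<^sub>F t in at_top. s (\<Omega> \<times> {t<..}) \<le> \<pi> t \<Omega>"
          using uc_minorants_le(1)[OF \<pi> sub]
          by (intro eventually_at_top_linorderI[of 0] s_le) auto
      qed (auto simp: ba_pos_D(2)[OF s])
      then show ?thesis using s by (simp add: frakM_def)
    qed
    moreover have "restr ?G s \<in> ca ?G"
    proof -
      let ?D = "restr ?G ` C"
      have ne': "?D \<noteq> {}" and pos': "?D \<subseteq> ba_pos ?G" and ca': "?D \<subseteq> ca ?G"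
        using ne D(4) restr_F_bar[OF subsetD[OF pos]] by auto
      have bd': "\<forall>x\<in>?D. x ?X \<le> \<pi> 0 \<Omega>"
        using bd Omega_bar_in_F_bar by (simp add: restr_def)
      have dir': "\<forall>k\<in>?D. \<forall>l\<in>?D. \<exists>n\<in>?D. \<forall>F\<in>?G. k F \<le> n F \<and> l F \<le> n F"
        using dir F_bar_subset by (simp add: restr_def) blast
      have "restr ?G s = (\<lambda>F. SUP l\<in>?D. l F)"
        using ne by (intro ext) (simp add: restr_def s_def image_image)
      then show ?thesis using directed_SUP(3)[OF algebra_F_bar ne' pos' bd' dir' ca'] by simp
    qed
    moreover have "s (\<Omega> \<times> {0}) = 0"
    proof (rule antisym[OF s_le ba_pos_D(2)[OF s]])
      show "x (\<Omega> \<times> {0}) \<le> 0" if "x \<in> C" for x using D(3)[OF that] by simp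
    qed
    moreover have "s (F \<times> {t<..u}) \<le> \<pi> t F - \<pi> u F" if "0 \<le> t" "t < u" "F \<in> A t" for t u F
      using D(5) that by (intro s_le) blast
    ultimately have "s \<in> uc_minorants \<pi>" by (simp add: uc_minorants_def frakM_uc_def)
    then show ?thesis using s_ge by blast
  qed
qed

text \<open>
  The countably additive part of \<open>y\<close> on \<open>F_bar\<close> extends to some \<open>z \<le> y\<close> on all sets. Then
  \<open>s + z\<close> is a minorant, and maximality of \<open>s\<close> forces \<open>z = 0\<close>.
\<close>

lemma remainder_is_up:
  assumes \<pi>: "potential \<pi>" and s: "s \<in> uc_minorants \<pi>"
    and max: "\<And>x. x \<in> uc_minorants \<pi> \<Longrightarrow> (\<And>B. s B \<le> x B) \<Longrightarrow> x = s"
    and y: "y \<in> frakM \<Omega>" "y (\<Omega> \<times> {0}) = 0"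
    and eq: "\<And>t F. 0 \<le> t \<Longrightarrow> F \<in> A t \<Longrightarrow> \<pi> t F = s (F \<times> {t<..}) + y (F \<times> {t<..})"
  shows "y \<in> frakM_up \<Omega> A"
proof -
  let ?X = "Omega_bar \<Omega>" and ?G = "F_bar \<Omega> A"
  note sD = uc_minorants_D[OF s]
  note sM = frakM_D[OF sD(2)] and yM = frakM_D[OF y(1)]
  from Yosida_Hewitt_pos[OF algebra_F_bar restr_F_bar[OF yM(1)]]
  obtain c where c: "c \<in> ca ?G" "c \<in> ba_pos ?G" "\<And>F. F \<in> ?G \<Longrightarrow> c F \<le> restr ?G y F"
    "(\<lambda>F. restr ?G y F - c F) \<in> pfa ?G"
    by metis
  have "c F \<le> y (?X \<inter> (\<lambda>b. b) -` F)" if "F \<in> ?G" for F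
    using c(3)[OF that] that F_bar_subset by (auto simp: restr_def Int_absorb1)
  from dominated_extension_exists[OF algebra_F_bar _ c(2) yM(1) this]
  obtain z where z: "z \<in> ba_pos (Pow ?X)" "\<And>B. z B \<le> y B" "\<And>F. F \<in> ?G \<Longrightarrow> z (?X \<inter> F) = c F"
    by auto
  have zM: "z \<in> frakM \<Omega>"
  proof -
    have "((\<lambda>t. z (\<Omega> \<times> {t<..})) \<longlongrightarrow> 0) at_top"
    proof (rule tendsto_sandwich[of "\<lambda>_. 0"])
      show "((\<lambda>t. y (\<Omega> \<times> {t<..})) \<longlongrightarrow> 0) at_top" using y(1) by (simp add: frakM_def)
    qed (simp_all add: z(2) ba_pos_D(2)[OF z(1)])
    then show ?thesis using z(1) by (simp add: frakM_def)
  qed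
  have rz: "restr ?G z = c"
  proof
    show "restr ?G z F = c F" for F
      using z(3)[of F] F_bar_subset ba_pos_D(3)[OF c(2), of F] by (auto simp: restr_def Int_absorb1)
  qed
  define x where "x = (\<lambda>B. s B + z B)"
  have "x \<in> uc_minorants \<pi>"
    unfolding uc_minorants_def frakM_uc_def
  proof (intro CollectI conjI allI impI ballI)
    show "x \<in> frakM \<Omega>"
      using ba_pos_add[OF sM(1) z(1)] sD(2) zM tendsto_add[of _ 0 at_top _ 0]
      by (force simp: frakM_def x_def)
    have "restr ?G x = (\<lambda>F. restr ?G s F + c F)"
      by (auto simp: x_def restr_def simp flip: rz)
    then show "restr ?G x \<in> ca ?G" using ca_add[OF sD(4) c(1)] by simp
    show "x (\<Omega> \<times> {0}) = 0"
      using sD(3) y(2) z(2)[of "\<Omega> \<times> {0}"] ba_pos_D(2)[OF z(1), of "\<Omega> \<times> {0}"] by (simp add: x_def)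
    fix t u :: real and F assume t: "0 \<le> t" "t < u" and F: "F \<in> A t"
    then have "F \<in> A u" using mono[of t u] by auto
    then show "x (F \<times> {t<..u}) \<le> \<pi> t F - \<pi> u F"
      using eq[OF t(1) F] eq[of u F] t z(2)[of "F \<times> {t<..u}"]
        rectangle_split(1)[OF sM(2) A_subset[OF t(1) F] t(1), of u]
        rectangle_split(1)[OF yM(2) A_subset[OF t(1) F] t(1), of u]
      by (simp add: x_def)
  qed
  then have "x = s" using ba_pos_D(2)[OF z(1)] by (intro max) (simp_all add: x_def)
  then have "z = (\<lambda>_. 0)" by (auto simp: x_def fun_eq_iff)
  then have "c = (\<lambda>_. 0)" using rz by (auto simp: restr_def)
  then show ?thesis using c(4) y(1) by (simp add: frakM_up_def)
qed

theorem decomposition_exists: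
  assumes \<xi>: "\<xi> \<in> frakS A"
  shows "\<exists>\<zeta>\<in>frakS_uc \<Omega> A. \<exists>\<eta>\<in>frakS_up \<Omega> A. \<xi> = (\<lambda>t F. \<zeta> t F + \<eta> t F)"
proof -
  define \<pi> where "\<pi> = (\<lambda>t F. \<xi> t F - xi_inf A \<xi> F)"
  have \<pi>: "potential \<pi>" unfolding \<pi>_def by (rule potential_of_frakS[OF \<xi>])
  obtain s where s: "s \<in> uc_minorants \<pi>"
    and max: "\<And>x. x \<in> uc_minorants \<pi> \<Longrightarrow> (\<And>B. s B \<le> x B) \<Longrightarrow> x = s"
    using maximal_uc_minorant_exists[OF \<pi>] by blast
  note sD = uc_minorants_D[OF s]
  obtain c p where cp: "c \<in> ca (union_alg A)" "p \<in> pfa (union_alg A)"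
    "xi_inf A \<xi> = (\<lambda>F. c F + p F)"
    using Yosida_Hewitt[OF algebra_union_alg xi_inf_ba[OF \<xi>]] .
  have pba: "p \<in> ba (union_alg A)" using cp(2) by (simp add: pfa_def)
  define \<zeta> where "\<zeta> = (\<lambda>t F. if 0 \<le> t \<and> F \<in> A t then c F + s (F \<times> {t<..}) else 0)"
  define \<eta> where "\<eta> = (\<lambda>t F. if 0 \<le> t \<and> F \<in> A t then p F + (\<pi> t F - s (F \<times> {t<..})) else 0)"
  note z = frakS_of_potential[OF ca_D[OF cp(1)] potential_frakM[OF sD(2)], folded \<zeta>_def]
  note e = frakS_of_potential[OF pba potential_minus[OF \<pi> sD(2,5)], folded \<eta>_def]
  have "s \<in> frakM_of \<Omega> A \<zeta>"
    using sD(2) z(2) by (auto simp: frakM_of_def \<zeta>_def)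
  then have "\<zeta> \<in> frakS_uc \<Omega> A" using z cp(1) sD(1) by (auto simp: frakS_uc_def)
  moreover have "\<eta> \<in> frakS_up \<Omega> A"
    unfolding frakS_up_def
  proof (intro CollectI conjI subsetI)
    show "\<eta> \<in> frakS A" "xi_inf A \<eta> \<in> pfa (union_alg A)" using e cp(2) by auto
    fix y assume "y \<in> {x \<in> frakM_of \<Omega> A \<eta>. x (\<Omega> \<times> {0}) = 0}"
    then have y: "y \<in> frakM \<Omega>" "y (\<Omega> \<times> {0}) = 0"
      "\<And>t F. 0 \<le> t \<Longrightarrow> F \<in> A t \<Longrightarrow> \<eta> t F = xi_inf A \<eta> F + y (F \<times> {t<..})"
      by (auto simp: frakM_of_def)
    have "\<pi> t F = s (F \<times> {t<..}) + y (F \<times> {t<..})" if "0 \<le> t" "F \<in> A t" for t F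
      using y(3)[OF that] that e(2) by (simp add: \<eta>_def)
    then show "y \<in> frakM_up \<Omega> A" 
      by (intro remainder_is_up[OF \<pi> s _ y(1,2)] max) auto
  qed
  moreover have "\<xi> = (\<lambda>t F. \<zeta> t F + \<eta> t F)"
    using cp(3) frakS_D(2)[OF \<xi>] by (auto simp: \<zeta>_def \<eta>_def \<pi>_def fun_eq_iff)
  ultimately show ?thesis by blast
qed

lemma xi_inf_add:
  assumes "\<xi> \<in> frakS A" "\<zeta> \<in> frakS A" "\<eta> \<in> frakS A" "\<xi> = (\<lambda>t F. \<zeta> t F + \<eta> t F)"
    and F: "F \<in> union_alg A"
  shows "xi_inf A \<xi> F = xi_inf A \<zeta> F + xi_inf A \<eta> F"
proof -
  obtain t where t: "0 \<le> t" "F \<in> A t" using F by (auto simp: union_alg_def)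
  have "((\<lambda>u. \<xi> u F) \<longlongrightarrow> xi_inf A \<zeta> F + xi_inf A \<eta> F) at_top"
    unfolding assms(4) by (intro tendsto_add xi_inf_tendsto[OF _ t] assms(2,3))
  then show ?thesis
    by (rule tendsto_unique[OF trivial_limit_at_top_linorder xi_inf_tendsto[OF assms(1) t]])
qed

lemma frakS_up_D:
  assumes "\<eta> \<in> frakS_up \<Omega> A"
  shows "\<eta> \<in> frakS A" "xi_inf A \<eta> \<in> pfa (union_alg A)"
  using assms by (auto simp: frakS_up_def)

lemma frakS_uc_D:
  assumes "\<zeta> \<in> frakS_uc \<Omega> A"
  shows "\<zeta> \<in> frakS A" "xi_inf A \<zeta> \<in> ca (union_alg A)"
  using assms by (auto simp: frakS_uc_def)

text \<open>
  If \<open>z1, z2\<close> represent \<open>\<zeta>1, \<zeta>2\<close>, then the excess of \<open>z1\<close> over \<open>z2\<close> on rectangles is absorbed by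
  \<open>\<eta>2\<close>: some \<open>x \<le> z1\<close> carries it and is a summand of a representation of \<open>\<eta>2\<close>. Being below \<open>z1\<close>
  and below that representation, \<open>x\<close> is both countably and purely finitely additive on \<open>F_bar\<close>.
\<close>

lemma uc_component_le:
  assumes \<zeta>: "\<zeta>1 \<in> frakS_uc \<Omega> A" "\<zeta>2 \<in> frakS_uc \<Omega> A"
    and \<eta>: "\<eta>1 \<in> frakS_up \<Omega> A" "\<eta>2 \<in> frakS_up \<Omega> A"
    and eq: "(\<lambda>t F. \<zeta>1 t F + \<eta>1 t F) = (\<lambda>t F. \<zeta>2 t F + \<eta>2 t F)"
    and inf: "xi_inf A \<zeta>1 = xi_inf A \<zeta>2" "xi_inf A \<eta>1 = xi_inf A \<eta>2"
    and t: "0 \<le> t" and F: "F \<in> A t"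
  shows "\<zeta>1 t F \<le> \<zeta>2 t F"
proof -
  let ?X = "Omega_bar \<Omega>" and ?G = "F_bar \<Omega> A"
  obtain z1 z2 where z: "z1 \<in> frakM \<Omega>" "z2 \<in> frakM \<Omega>" "restr ?G z1 \<in> ca ?G"
    and z1: "\<And>t F. 0 \<le> t \<Longrightarrow> F \<in> A t \<Longrightarrow> \<zeta>1 t F = xi_inf A \<zeta>1 F + z1 (F \<times> {t<..})"
    and z2: "\<And>t F. 0 \<le> t \<Longrightarrow> F \<in> A t \<Longrightarrow> \<zeta>2 t F = xi_inf A \<zeta>2 F + z2 (F \<times> {t<..})"
    using \<zeta> by (fastforce simp: frakS_uc_def frakM_of_def frakM_uc_def)
  obtain w1 where w1: "w1 \<in> frakM \<Omega>"
    "\<And>t F. 0 \<le> t \<Longrightarrow> F \<in> A t \<Longrightarrow> w1 (F \<times> {t<..}) = \<eta>1 t F - xi_inf A \<eta>1 F"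
    using potential_representation[OF potential_of_frakS[OF frakS_up_D(1)[OF \<eta>(1)]]] by blast
  obtain w2 where w2: "w2 \<in> frakM \<Omega>"
    "\<And>t F. 0 \<le> t \<Longrightarrow> F \<in> A t \<Longrightarrow> w2 (F \<times> {t<..}) = \<eta>2 t F - xi_inf A \<eta>2 F"
    using potential_representation[OF potential_of_frakS[OF frakS_up_D(1)[OF \<eta>(2)]]] by blast
  have "z1 (F \<times> {t<..}) + w1 (F \<times> {t<..}) = z2 (F \<times> {t<..}) + w2 (F \<times> {t<..})"
    if "0 \<le> t" "F \<in> A t" for t F
    using fun_cong[OF fun_cong[OF eq, of t], of F] z1[OF that] z2[OF that] w1(2)[OF that]
      w2(2)[OF that] inf by simp
  from common_part_exists[OF z(1,2) w1(1) w2(1) this]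
  obtain x where x: "x \<in> frakM \<Omega>" "x (\<Omega> \<times> {0}) = 0" "\<And>B. x B \<le> z1 B"
    and x_ge: "\<And>t u F. 0 \<le> t \<Longrightarrow> t < u \<Longrightarrow> F \<in> A t \<Longrightarrow>
      z1 (F \<times> {t<..u}) - z2 (F \<times> {t<..u}) \<le> x (F \<times> {t<..u})"
    and x_le: "\<And>t u F. 0 \<le> t \<Longrightarrow> t < u \<Longrightarrow> F \<in> A t \<Longrightarrow> x (F \<times> {t<..u}) \<le> w2 (F \<times> {t<..u})"
    by blast
  note xM = frakM_D[OF x(1)]
  have "x (F \<times> {t<..u}) \<le> w2 (F \<times> {t<..}) - w2 (F \<times> {u<..})"
    if "0 \<le> t" "t < u" "F \<in> A t" for t u F
    using x_le[OF that] rectangle_split(1)[OF frakM_D(2)[OF w2(1)] A_subset[OF that(1,3)] that(1), of u]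
      that(2) by simp
  from potential_representation[OF potential_minus[OF potential_frakM[OF w2(1)] x(1) this]]
  obtain v where v: "v \<in> frakM \<Omega>" "v (\<Omega> \<times> {0}) = 0"
    "\<And>t F. 0 \<le> t \<Longrightarrow> F \<in> A t \<Longrightarrow> v (F \<times> {t<..}) = w2 (F \<times> {t<..}) - x (F \<times> {t<..})"
    by blast
  define y where "y = (\<lambda>B. x B + v B)"
  have y: "y \<in> frakM \<Omega>"
    using ba_pos_add[OF xM(1) frakM_D(1)[OF v(1)]] x(1) v(1) tendsto_add[of _ 0 at_top _ 0]
    by (force simp: frakM_def y_def)
  then have "y \<in> frakM_of \<Omega> A \<eta>2"
    using v(3) w2(2) by (simp add: frakM_of_def y_def)
  moreover have "y (\<Omega> \<times> {0}) = 0" using x(2) v(2) by (simp add: y_def)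
  ultimately have pfa: "restr ?G y \<in> pfa ?G" using \<eta>(2) by (auto simp: frakS_up_def frakM_up_def)
  have "restr ?G x \<in> ca ?G"
    using x(3) by (intro ca_solid[OF algebra_F_bar restr_F_bar[OF xM(1)] z(3)]) (simp add: restr_def)
  moreover have "restr ?G x F \<le> ba_abs ?G (restr ?G y) F" if "F \<in> ?G" for F
    using ba_pos_D(2)[OF frakM_D(1)[OF v(1)], of F] ba_abs_pos[OF algebra_F_bar restr_F_bar] frakM_D(1)[OF y] that
    by (simp add: restr_def y_def)
  ultimately have "restr ?G x = (\<lambda>_. 0)"
    using pfa restr_F_bar[OF xM(1)] unfolding pfa_iff[OF algebra_F_bar] by blast
  then have "x ?X = 0" using Omega_bar_in_F_bar by (metis restr_def)
  then have "x = (\<lambda>_. 0)" by (rule ba_pos_eq_zero[OF algebra_Pow xM(1)])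
  then have le: "z1 (F \<times> {t<..u}) \<le> z2 (F \<times> {t<..u})" if "t < u" for u
    using x_ge[OF t that F] by simp
  have "z1 (F \<times> {t<..}) \<le> z2 (F \<times> {t<..})"
  proof (rule tendsto_le[OF trivial_limit_at_top_linorder])
    show "((\<lambda>u. z1 (F \<times> {t<..u})) \<longlongrightarrow> z1 (F \<times> {t<..})) at_top"
      "((\<lambda>u. z2 (F \<times> {t<..u})) \<longlongrightarrow> z2 (F \<times> {t<..})) at_top"
      using frakM_tendsto(2) z(1,2) A_subset[OF t F] t by blast+
    show "\<forall>\<^sub>F u in at_top. z1 (F \<times> {t<..u}) \<le> z2 (F \<times> {t<..u})"
      using le by (auto intro!: eventually_at_top_linorderI[of "t + 1"])
  qed
  then show ?thesis using z1[OF t F] z2[OF t F] inf by simp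
qed

theorem decomposition_unique:
  assumes \<zeta>: "\<zeta>1 \<in> frakS_uc \<Omega> A" "\<zeta>2 \<in> frakS_uc \<Omega> A"
    and \<eta>: "\<eta>1 \<in> frakS_up \<Omega> A" "\<eta>2 \<in> frakS_up \<Omega> A"
    and \<xi>: "\<xi> \<in> frakS A"
    and eq: "\<xi> = (\<lambda>t F. \<zeta>1 t F + \<eta>1 t F)" "\<xi> = (\<lambda>t F. \<zeta>2 t F + \<eta>2 t F)"
  shows "\<zeta>1 = \<zeta>2 \<and> \<eta>1 = \<eta>2"
proof -
  note uc = frakS_uc_D[OF \<zeta>(1)] frakS_uc_D[OF \<zeta>(2)]
  note up = frakS_up_D[OF \<eta>(1)] frakS_up_D[OF \<eta>(2)]
  have "xi_inf A \<zeta>1 F + xi_inf A \<eta>1 F = xi_inf A \<zeta>2 F + xi_inf A \<eta>2 F" if "F \<in> union_alg A" for F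
    using xi_inf_add[OF \<xi> uc(1) up(1) eq(1) that] xi_inf_add[OF \<xi> uc(3) up(3) eq(2) that] by simp
  note inf = Yosida_Hewitt_unique[OF algebra_union_alg uc(2,4) up(2,4) this]
  have sum: "(\<lambda>t F. \<zeta>1 t F + \<eta>1 t F) = (\<lambda>t F. \<zeta>2 t F + \<eta>2 t F)" using eq by simp
  have "\<zeta>1 t F = \<zeta>2 t F" for t F
  proof (cases "0 \<le> t \<and> F \<in> A t")
    case True
    then show ?thesis
      using uc_component_le[OF \<zeta> \<eta> sum inf]
        uc_component_le[OF \<zeta>(2,1) \<eta>(2,1) sum[symmetric] inf[symmetric]] by (simp add: antisym)
  next
    case False
    then show ?thesis using frakS_D(2)[OF uc(1)] frakS_D(2)[OF uc(3)] by simp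
  qed
  then have z: "\<zeta>1 = \<zeta>2" by (simp add: fun_eq_iff)
  then show ?thesis using fun_cong[OF fun_cong[OF sum]] by (auto simp: fun_eq_iff)
qed

end

theorem proposition2:
  fixes \<Omega> :: "'a set" and A :: "real \<Rightarrow> 'a set set" and \<xi> :: "real \<Rightarrow> 'a set \<Rightarrow> real"
  assumes "\<And>t. t \<ge> 0 \<Longrightarrow> algebra \<Omega> (A t)"
    and "\<And>t u. 0 \<le> t \<Longrightarrow> t \<le> u \<Longrightarrow> A t \<subseteq> A u"
    and "\<xi> \<in> frakS A"
  shows "\<exists>!(p :: (real \<Rightarrow> 'a set \<Rightarrow> real) \<times> (real \<Rightarrow> 'a set \<Rightarrow> real)).
    fst p \<in> frakS_uc \<Omega> A \<and> snd p \<in> frakS_up \<Omega> A \<and> \<xi> = (\<lambda>t F. fst p t F + snd p t F)"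
proof -
  interpret algebra_filtration \<Omega> A
    by (rule algebra_filtration.intro) (fact assms(1,2))+
  obtain \<zeta> \<eta> where d: "\<zeta> \<in> frakS_uc \<Omega> A" "\<eta> \<in> frakS_up \<Omega> A" "\<xi> = (\<lambda>t F. \<zeta> t F + \<eta> t F)"
    using decomposition_exists[OF assms(3)] by blast
  show ?thesis
  proof (rule ex1I[of _ "(\<zeta>, \<eta>)"])
    fix p assume p: "fst p \<in> frakS_uc \<Omega> A \<and> snd p \<in> frakS_up \<Omega> A \<and> \<xi> = (\<lambda>t F. fst p t F + snd p t F)"
    then show "p = (\<zeta>, \<eta>)"
      using decomposition_unique[of "fst p" \<zeta> "snd p" \<eta> \<xi>] d assms(3) by (simp add: prod_eq_iff)
  qed (use d in simp)
qed

end
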